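(* Let $(X,R)$ be a circularly ordered topological space (COTS), i.e. a circularly ordered set equipped with its interval topology $\lambda_R$. Let $\mathfrak B$ be the family of all finite "star covers" of $X$, where for any finite cycle $F=[a_1,\dots,a_n]$ in $X$ the star cover $\mathcal C_F$ is defined as $$\mathcal C_F:=\{(a_i,a_{i+2})_R: i=1,\dots,n\}\quad(\text{indices modulo } n).$$ Let $\mu_{\circ}$ be the (covering) uniformity on $X$ generated by the family $\mathfrak B$ as a base. Then $\mu_\circ$ is a precompact convex uniformity, agrees with the interval topology $\lambda_R$, and is equal to the Novák compactification uniformity $\mu_R$.
   Context: A circular order on a set $X$ is a ternary relation $R\subseteq X^3$ (write $[a,b,c]$ for $(a,b,c)\in R$) satisfying: cyclicity ($[a,b,c]\Rightarrow[b,c,a]$); asymmetry ($[a,b,c]\Rightarrow (c,b,a)\notin R$); transitivity ($[a,b,c]$ and $[a,c,d]$ imply $[a,b,d]$); totality (if $a,b,c$ are distinct then $[a,b,c]$ or $[a,c,b]$). Put $(a,b)_R:=\{x\in X:[a,x,b]\}$ and $[a,b]_R:=(a,b)_R\cup\{a,b\}$. The interval topology $\lambda_R$ is the topology on $X$ with base $\{X\setminus[a,b]_R: a,b\in X\}\cup\{X\}$. An (injective) cycle $[a_1,\dots,a_n]$ in $X$ is a tuple of distinct points such that $[a_i,a_j,a_k]$ whenever $i,j,k$ are in the standard cyclic order modulo $n$. A subset $C\subseteq X$ is convex if for all $a,b\in C$ at least one of $[a,b]_R$, $[b,a]_R$ is contained in $C$. A uniformity (in the sense of uniform covers) is convex if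 it is compatible with the topology and has a base consisting of covers all of whose members are convex; it is precompact if it has a base of finite covers. Novák's regular completion. A cut on $(X,R)$ is a linear order $\leq$ on $X$ such that $a<b<c$ implies $[a,b,c]$. A gap is a cut having neither a least nor a greatest element. For $x\in X$ the lower point-cut $\leq_x$ is the linear order with least element $x$ and $a<_x b\iff[x,a,b]$ for $a,b\neq x$. $\mathcal X_r$ is the set of all gaps and all lower point-cuts. For distinct $L_1,L_2,L_3\in\mathcal X_r$ put $[L_1,L_2,L_3]_{\mathcal R}$ iff there is a partition $X=A\sqcup B\sqcup D$ into nonempty pieces such that $(X,L_1)=A\oplus B\oplus D$, $(X,L_2)=B\oplus D\oplus A$, $(X,L_3)=D\oplus A\oplus B$, where $\oplus$ denotes the ordinal sum of linearly ordered sets. Then $\mathcal R$ is a circular order on $\mathcal X_r$ with compact interval topology, and $\nu:X\to\mathcal X_r$, $x\mapsto\ \leq_x$, is a dense topological and circular order embedding. The Novák compactification uniformity $\mu_R$ is the uniformity on $X$ induced via $\nu$ from the unique compatible uniformity of the compact Hausdorff space $\mathcal X_r$.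
   Formalization: Sets X with exactly two points are excluded, since there no star cover covers X while the interval topology is discrete; star covers are taken only for cycles with n ≥ 3, as otherwise all arcs (a_i, a_{i+2}) are empty; for at most one point the generated uniformity is the trivial one. *)

theory Defs
  imports "HOL-Analysis.Analysis"
begin

section \<open>Circular orders\<close>

definition circular_order_on :: "'a set \<Rightarrow> ('a \<times> 'a \<times> 'a) set \<Rightarrow> bool" where
  "circular_order_on X R \<longleftrightarrow>
     R \<subseteq> X \<times> X \<times> X \<and>
     (\<forall>a b c. (a, b, c) \<in> R \<longrightarrow> (b, c, a) \<in> R) \<and>
     (\<forall>a b c. (a, b, c) \<in> R \<longrightarrow> (c, b, a) \<notin> R) \<and>
     (\<forall>a b c d. (a, b, c) \<in> R \<longrightarrow> (a, c, d) \<in> R \<longrightarrow> (a, b, d) \<in> R) \<and>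
     (\<forall>a\<in>X. \<forall>b\<in>X. \<forall>c\<in>X. a \<noteq> b \<longrightarrow> b \<noteq> c \<longrightarrow> a \<noteq> c \<longrightarrow> (a, b, c) \<in> R \<or> (a, c, b) \<in> R)"

definition open_arc :: "('a \<times> 'a \<times> 'a) set \<Rightarrow> 'a \<Rightarrow> 'a \<Rightarrow> 'a set" where
  "open_arc R a b = {x. (a, x, b) \<in> R}"

definition closed_arc :: "('a \<times> 'a \<times> 'a) set \<Rightarrow> 'a \<Rightarrow> 'a \<Rightarrow> 'a set" where
  "closed_arc R a b = open_arc R a b \<union> {a, b}"

definition interval_base :: "'a set \<Rightarrow> ('a \<times> 'a \<times> 'a) set \<Rightarrow> 'a set set" where
  "interval_base X R = {X - closed_arc R a b | a b. a \<in> X \<and> b \<in> X} \<union> {X}"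

text \<open>The family above is a base, not merely a subbase, of this topology:
  see \<open>openin_interval_topology\<close> below.\<close>

definition interval_topology :: "'a set \<Rightarrow> ('a \<times> 'a \<times> 'a) set \<Rightarrow> 'a topology" where
  "interval_topology X R = topology_generated_by (interval_base X R)"

definition circ_convex :: "'a set \<Rightarrow> ('a \<times> 'a \<times> 'a) set \<Rightarrow> 'a set \<Rightarrow> bool" where
  "circ_convex X R C \<longleftrightarrow>
     C \<subseteq> X \<and> (\<forall>a\<in>C. \<forall>b\<in>C. closed_arc R a b \<subseteq> C \<or> closed_arc R b a \<subseteq> C)"

text \<open>A cycle \<open>[a\<^sub>1, \<dots>, a\<^sub>n]\<close> is a list, hence indexed from \<open>0\<close>.\<close>

definition cycle_in :: "'a set \<Rightarrow> ('a \<times> 'a \<times> 'a) set \<Rightarrow> 'a list \<Rightarrow> bool" where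
  "cycle_in X R F \<longleftrightarrow>
     set F \<subseteq> X \<and> distinct F \<and>
     (\<forall>i j k. i < length F \<longrightarrow> j < length F \<longrightarrow> k < length F \<longrightarrow>
        i < j \<and> j < k \<or> j < k \<and> k < i \<or> k < i \<and> i < j \<longrightarrow>
        (F ! i, F ! j, F ! k) \<in> R)"

section \<open>Uniformities in the sense of uniform covers\<close>

definition cover_of :: "'a set \<Rightarrow> 'a set set \<Rightarrow> bool" where
  "cover_of X \<C> \<longleftrightarrow> \<Union>\<C> = X"

definition cover_refines :: "'a set set \<Rightarrow> 'a set set \<Rightarrow> bool" where
  "cover_refines \<C> \<D> \<longleftrightarrow> (\<forall>A\<in>\<C>. \<exists>B\<in>\<D>. A \<subseteq> B)"

definition cover_star :: "'a set \<Rightarrow> 'a set set \<Rightarrow> 'a set" where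
  "cover_star S \<C> = \<Union>{A \<in> \<C>. A \<inter> S \<noteq> {}}"

definition star_refines :: "'a set set \<Rightarrow> 'a set set \<Rightarrow> bool" where
  "star_refines \<C> \<D> \<longleftrightarrow> (\<forall>A\<in>\<C>. \<exists>B\<in>\<D>. cover_star A \<C> \<subseteq> B)"

definition covering_uniformity :: "'a set \<Rightarrow> 'a set set set \<Rightarrow> bool" where
  "covering_uniformity X \<mu> \<longleftrightarrow>
     \<mu> \<noteq> {} \<and>
     (\<forall>\<C>\<in>\<mu>. cover_of X \<C>) \<and>
     (\<forall>\<C> \<D>. \<C> \<in> \<mu> \<longrightarrow> cover_of X \<D> \<longrightarrow> cover_refines \<C> \<D> \<longrightarrow> \<D> \<in> \<mu>) \<and>
     (\<forall>\<C>\<in>\<mu>. \<forall>\<D>\<in>\<mu>. \<exists>\<E>\<in>\<mu>. star_refines \<E> \<C> \<and> star_refines \<E> \<D>)"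

definition uniformity_base :: "'a set set set \<Rightarrow> 'a set set set \<Rightarrow> bool" where
  "uniformity_base \<mu> \<B> \<longleftrightarrow> \<B> \<subseteq> \<mu> \<and> (\<forall>\<C>\<in>\<mu>. \<exists>\<D>\<in>\<B>. cover_refines \<D> \<C>)"

text \<open>The trivial cover \<open>{X}\<close> only matters for \<open>\<B> = {}\<close>, since every cover of \<open>X\<close> refines it;
  the empty family thus generates the trivial uniformity.\<close>

definition generated_uniformity :: "'a set \<Rightarrow> 'a set set set \<Rightarrow> 'a set set set" where
  "generated_uniformity X \<B> = {\<C>. cover_of X \<C> \<and> (\<exists>\<D>\<in>insert {X} \<B>. cover_refines \<D> \<C>)}"

text \<open>The right-hand side describes a topology whenever \<open>\<mu>\<close> is a covering uniformity on \<open>X\<close>: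
  see \<open>openin_uniform_topology\<close> below.\<close>

definition uniform_topology :: "'a set \<Rightarrow> 'a set set set \<Rightarrow> 'a topology" where
  "uniform_topology X \<mu> =
     topology (\<lambda>U. U \<subseteq> X \<and> (\<forall>x\<in>U. \<exists>\<C>\<in>\<mu>. cover_star {x} \<C> \<subseteq> U))"

definition compatible_uniformity :: "'a topology \<Rightarrow> 'a set set set \<Rightarrow> bool" where
  "compatible_uniformity T \<mu> \<longleftrightarrow>
     covering_uniformity (topspace T) \<mu> \<and> uniform_topology (topspace T) \<mu> = T"

definition precompact_uniformity :: "'a set set set \<Rightarrow> bool" where
  "precompact_uniformity \<mu> \<longleftrightarrow> (\<exists>\<B>. uniformity_base \<mu> \<B> \<and> (\<forall>\<C>\<in>\<B>. finite \<C>))"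

definition convex_uniformity ::
    "'a set \<Rightarrow> ('a \<times> 'a \<times> 'a) set \<Rightarrow> 'a set set set \<Rightarrow> bool" where
  "convex_uniformity X R \<mu> \<longleftrightarrow>
     compatible_uniformity (interval_topology X R) \<mu> \<and>
     (\<exists>\<B>. uniformity_base \<mu> \<B> \<and> (\<forall>\<C>\<in>\<B>. \<forall>C\<in>\<C>. circ_convex X R C))"

definition induced_uniformity ::
    "'a set \<Rightarrow> ('a \<Rightarrow> 'b) \<Rightarrow> 'b set set set \<Rightarrow> 'a set set set" where
  "induced_uniformity X f \<mu> =
     {\<C>. cover_of X \<C> \<and> (\<exists>\<V>\<in>\<mu>. cover_refines ((\<lambda>V. f -` V \<inter> X) ` \<V>) \<C>)}"

section \<open>Star covers\<close>

definition star_cover :: "('a \<times> 'a \<times> 'a) set \<Rightarrow> 'a list \<Rightarrow> 'a set set" where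
  "star_cover R F = {open_arc R (F ! i) (F ! ((i + 2) mod length F)) | i. i < length F}"

text \<open>For \<open>n \<le> 2\<close> the indices \<open>i\<close> and \<open>i + 2\<close> coincide modulo \<open>n\<close>, all the arcs are empty and
  \<open>star_cover R F\<close> does not cover \<open>F\<close>; so only cycles with at least three points give covers.\<close>

definition star_covers :: "'a set \<Rightarrow> ('a \<times> 'a \<times> 'a) set \<Rightarrow> 'a set set set" where
  "star_covers X R = {star_cover R F | F. cycle_in X R F \<and> 3 \<le> length F}"

definition star_uniformity :: "'a set \<Rightarrow> ('a \<times> 'a \<times> 'a) set \<Rightarrow> 'a set set set" where
  "star_uniformity X R = generated_uniformity X (star_covers X R)"

section \<open>Novak's regular completion\<close>

text \<open>Linear orders are reflexive relations, as in \<^const>\<open>linear_order_on\<close>.\<close>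

definition circ_cut :: "'a set \<Rightarrow> ('a \<times> 'a \<times> 'a) set \<Rightarrow> 'a rel \<Rightarrow> bool" where
  "circ_cut X R L \<longleftrightarrow>
     linear_order_on X L \<and>
     (\<forall>a b c. (a, b) \<in> L \<longrightarrow> a \<noteq> b \<longrightarrow> (b, c) \<in> L \<longrightarrow> b \<noteq> c \<longrightarrow> (a, b, c) \<in> R)"

definition circ_gap :: "'a set \<Rightarrow> ('a \<times> 'a \<times> 'a) set \<Rightarrow> 'a rel \<Rightarrow> bool" where
  "circ_gap X R L \<longleftrightarrow>
     circ_cut X R L \<and>
     \<not> (\<exists>m\<in>X. \<forall>x\<in>X. (m, x) \<in> L) \<and>
     \<not> (\<exists>m\<in>X. \<forall>x\<in>X. (x, m) \<in> L)"

definition lower_point_cut :: "'a set \<Rightarrow> ('a \<times> 'a \<times> 'a) set \<Rightarrow> 'a \<Rightarrow> 'a rel" where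
  "lower_point_cut X R x = {(a, b). a \<in> X \<and> b \<in> X \<and> (a = b \<or> a = x \<or> (x, a, b) \<in> R)}"

definition novak_points :: "'a set \<Rightarrow> ('a \<times> 'a \<times> 'a) set \<Rightarrow> 'a rel set" where
  "novak_points X R = {L. circ_gap X R L} \<union> lower_point_cut X R ` X"

definition ordinal_sum :: "'a rel \<Rightarrow> 'a rel \<Rightarrow> 'a rel" (infixr "\<oplus>\<^sub>o" 65) where
  "r \<oplus>\<^sub>o s = r \<union> s \<union> Field r \<times> Field s"

definition novak_order ::
    "'a set \<Rightarrow> ('a \<times> 'a \<times> 'a) set \<Rightarrow> ('a rel \<times> 'a rel \<times> 'a rel) set" where
  "novak_order X R =
     {(L1, L2, L3).
        L1 \<in> novak_points X R \<and> L2 \<in> novak_points X R \<and> L3 \<in> novak_points X R \<and>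
        L1 \<noteq> L2 \<and> L2 \<noteq> L3 \<and> L1 \<noteq> L3 \<and>
        (\<exists>A B D rA rB rD.
           A \<noteq> {} \<and> B \<noteq> {} \<and> D \<noteq> {} \<and>
           A \<inter> B = {} \<and> B \<inter> D = {} \<and> A \<inter> D = {} \<and> A \<union> B \<union> D = X \<and>
           linear_order_on A rA \<and> linear_order_on B rB \<and> linear_order_on D rD \<and>
           L1 = rA \<oplus>\<^sub>o rB \<oplus>\<^sub>o rD \<and>
           L2 = rB \<oplus>\<^sub>o rD \<oplus>\<^sub>o rA \<and>
           L3 = rD \<oplus>\<^sub>o rA \<oplus>\<^sub>o rB)}"

definition novak_topology :: "'a set \<Rightarrow> ('a \<times> 'a \<times> 'a) set \<Rightarrow> 'a rel topology" where
  "novak_topology X R = interval_topology (novak_points X R) (novak_order X R)"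

definition novak_uniformity :: "'a set \<Rightarrow> ('a \<times> 'a \<times> 'a) set \<Rightarrow> 'a set set set" where
  "novak_uniformity X R =
     induced_uniformity X (lower_point_cut X R)
       (THE \<mu>. compatible_uniformity (novak_topology X R) \<mu>)"

section \<open>The two topologies are as described\<close>

lemma closed_arc_hull:
  assumes R: "circular_order_on X R"
    and X: "a \<in> X" "b \<in> X" "c \<in> X" "d \<in> X" "x \<in> X"
    and x: "x \<notin> closed_arc R a b" "x \<notin> closed_arc R c d"
  shows "\<exists>e\<in>X. \<exists>f\<in>X. x \<notin> closed_arc R e f \<and> closed_arc R a b \<union> closed_arc R c d \<subseteq> closed_arc R e f"
proof -
  note RR = R[unfolded circular_order_on_def]
  note RR1 = RR[THEN conjunct2] note RR2 = RR1[THEN conjunct2]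
  note RR3 = RR2[THEN conjunct2] note RR4 = RR3[THEN conjunct2]
  have cyc: "(p, q, r) \<in> R \<Longrightarrow> (q, r, p) \<in> R" for p q r
    by (rule RR1[THEN conjunct1, rule_format])
  have asym: "(p, q, r) \<in> R \<Longrightarrow> (r, q, p) \<in> R \<Longrightarrow> False" for p q r
    using RR2[THEN conjunct1, rule_format, of p q r] by simp
  have tr: "(p, q, r) \<in> R \<Longrightarrow> (p, r, s) \<in> R \<Longrightarrow> (p, q, s) \<in> R" for p q r s
    by (rule RR3[THEN conjunct1, rule_format])
  have tot: "p \<in> X \<Longrightarrow> q \<in> X \<Longrightarrow> r \<in> X \<Longrightarrow> p \<noteq> q \<Longrightarrow> q \<noteq> r \<Longrightarrow> p \<noteq> r \<Longrightarrow>
      (p, q, r) \<in> R \<or> (p, r, q) \<in> R" for p q r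
    using RR4[rule_format, of p q r] by simp
  define le where "le p q \<longleftrightarrow> p = q \<or> (x, p, q) \<in> R" for p q
  have le_trans: "le p q \<Longrightarrow> le q r \<Longrightarrow> le p r" for p q r
    unfolding le_def using tr[of x p q r] by auto
  have le_tot: "p \<in> X \<Longrightarrow> q \<in> X \<Longrightarrow> p \<noteq> x \<Longrightarrow> q \<noteq> x \<Longrightarrow> le p q \<or> le q p" for p q
    unfolding le_def using tot[of x p q] X(5) by auto
  have mem: "y \<in> closed_arc R p q \<longleftrightarrow> y \<noteq> x \<and> le p y \<and> le y q"
    if "p \<in> X" "q \<in> X" "p \<noteq> x" "q \<noteq> x" "le p q" for p q y
  proof
    assume y: "y \<in> closed_arc R p q"
    show "y \<noteq> x \<and> le p y \<and> le y q"
    proof (cases "y = p \<or> y = q")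
      case True
      then show ?thesis using that by (auto simp: le_def)
    next
      case False
      then have pyq: "(p, y, q) \<in> R" using y by (auto simp: closed_arc_def open_arc_def)
      then have "p \<noteq> q" using asym[of p y q] by auto
      then have xpq: "(x, p, q) \<in> R" using that by (auto simp: le_def)
      have yx: "y \<noteq> x" using asym[OF xpq] cyc[OF cyc[OF pyq]] cyc[OF pyq] pyq by blast
      have qxp: "(q, x, p) \<in> R" and qpy: "(q, p, y) \<in> R"
        using cyc[OF cyc[OF xpq]] cyc[OF cyc[OF pyq]] .
      have qxy: "(q, x, y) \<in> R" using tr[OF qxp qpy] .
      have ypx: "(p, y, x) \<in> R" using tr[OF pyq cyc[OF xpq]] .
      have "(x, p, y) \<in> R" "(x, y, q) \<in> R"
        using cyc[OF cyc[OF ypx]] cyc[OF qxy] .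
      then show ?thesis using yx by (auto simp: le_def)
    qed
  next
    assume y: "y \<noteq> x \<and> le p y \<and> le y q"
    show "y \<in> closed_arc R p q"
    proof (cases "y = p \<or> y = q")
      case True
      then show ?thesis by (auto simp: closed_arc_def)
    next
      case False
      then have "(x, p, y) \<in> R" "(x, y, q) \<in> R" using y by (auto simp: le_def)
      then have "(y, q, p) \<in> R" using tr[of y q x p] cyc[of x y q] cyc[of x p y] cyc[of p y x] by simp
      then have "(p, y, q) \<in> R" using cyc[of y q p] cyc[of q p y] by simp
      then show ?thesis by (auto simp: closed_arc_def open_arc_def)
    qed
  qed
  have arc_le: "le p q" if "p \<in> X" "q \<in> X" "x \<notin> closed_arc R p q" for p q
    using that tot[of x p q] X(5) cyc[of x q p] cyc[of q p x]
    unfolding le_def closed_arc_def open_arc_def by auto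
  have ne: "a \<noteq> x" "b \<noteq> x" "c \<noteq> x" "d \<noteq> x"
    using x by (auto simp: closed_arc_def)
  have ab: "le a b" and cd: "le c d" using arc_le X x by auto
  define e where "e = (if le a c then a else c)"
  define f where "f = (if le b d then d else b)"
  have e: "e \<in> X" "e \<noteq> x" "le e a" "le e c"
    using X ne le_tot[of a c] by (auto simp: e_def le_def)
  have f: "f \<in> X" "f \<noteq> x" "le b f" "le d f"
    using X ne le_tot[of b d] by (auto simp: f_def le_def)
  have ef: "le e f" using le_trans[OF le_trans[OF e(3) ab] f(3)] .
  have "x \<notin> closed_arc R e f" using mem[OF e(1) f(1) e(2) f(2) ef] by simp
  moreover have "closed_arc R a b \<union> closed_arc R c d \<subseteq> closed_arc R e f"
    using mem[OF e(1) f(1) e(2) f(2) ef] mem[OF X(1,2) ne(1,2) ab] mem[OF X(3,4) ne(3,4) cd]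
      le_trans[OF e(3)] le_trans[OF e(4)] le_trans[OF _ f(3)] le_trans[OF _ f(4)] by auto
  ultimately show ?thesis using e(1) f(1) by blast
qed

lemma openin_interval_topology:
  assumes "circular_order_on X R"
  shows "openin (interval_topology X R) = arbitrary union_of (\<lambda>U. U \<in> interval_base X R)"
proof -
  have int: "\<exists>W\<in>interval_base X R. z \<in> W \<and> W \<subseteq> U \<inter> V"
    if UV: "U \<in> interval_base X R" "V \<in> interval_base X R" "z \<in> U \<inter> V" for U V z
  proof (cases "U = X \<or> V = X")
    case True
    have "U \<subseteq> X" "V \<subseteq> X" using UV by (auto simp: interval_base_def)
    then show ?thesis using True UV by blast
  next
    case False
    then obtain a b c d where abcd: "a \<in> X" "b \<in> X" "c \<in> X" "d \<in> X"
      "U = X - closed_arc R a b" "V = X - closed_arc R c d"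
      using UV unfolding interval_base_def by blast
    then obtain e f where "e \<in> X" "f \<in> X" "z \<notin> closed_arc R e f"
      "closed_arc R a b \<union> closed_arc R c d \<subseteq> closed_arc R e f"
      using closed_arc_hull[OF assms, of a b c d z] UV(3) by auto
    then have "X - closed_arc R e f \<in> interval_base X R" "z \<in> X - closed_arc R e f"
      "X - closed_arc R e f \<subseteq> U \<inter> V"
      using abcd UV(3) by (auto simp: interval_base_def)
    then show ?thesis by blast
  qed
  show ?thesis
    unfolding openin_topology_base_unique
  proof (intro conjI allI impI)
    fix V assume "V \<in> interval_base X R"
    then show "openin (interval_topology X R) V"
      unfolding interval_topology_def by (rule topology_generated_by_Basis)
  next
    fix U x assume "openin (interval_topology X R) U \<and> x \<in> U"
    then have "generate_topology_on (interval_base X R) U" and "x \<in> U"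
      by (auto simp: interval_topology_def openin_topology_generated_by_iff)
    then show "\<exists>V. V \<in> interval_base X R \<and> x \<in> V \<and> V \<subseteq> U"
    proof (induction U arbitrary: x)
      case Empty
      then show ?case by simp
    next
      case (Int a b)
      then obtain V W where "V \<in> interval_base X R" "x \<in> V" "V \<subseteq> a"
        "W \<in> interval_base X R" "x \<in> W" "W \<subseteq> b" by (metis IntD1 IntD2)
      then show ?case using int[of V W x] by blast
    next
      case (UN K)
      then show ?case by (meson Union_iff Union_upper subset_trans)
    next
      case (Basis s)
      then show ?case by blast
    qed
  qed
qed

lemma openin_uniform_topology:
  assumes "covering_uniformity X \<mu>"
  shows "openin (uniform_topology X \<mu>) U \<longleftrightarrow>
    U \<subseteq> X \<and> (\<forall>x\<in>U. \<exists>\<C>\<in>\<mu>. cover_star {x} \<C> \<subseteq> U)"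
proof -
  have sub: "cover_star {x} \<E> \<subseteq> cover_star {x} \<C>"
    if "star_refines \<E> \<C>" for x \<E> and \<C> :: "'a set set"
  proof
    fix y assume "y \<in> cover_star {x} \<E>"
    then obtain A where A: "A \<in> \<E>" "x \<in> A" "y \<in> A" by (auto simp: cover_star_def)
    then obtain B where "B \<in> \<C>" "cover_star A \<E> \<subseteq> B" using \<open>star_refines \<E> \<C>\<close>
      unfolding star_refines_def by blast
    moreover have "A \<subseteq> cover_star A \<E>" using A by (auto simp: cover_star_def)
    ultimately show "y \<in> cover_star {x} \<C>" using A by (auto simp: cover_star_def)
  qed
  have "istopology (\<lambda>U. U \<subseteq> X \<and> (\<forall>x\<in>U. \<exists>\<C>\<in>\<mu>. cover_star {x} \<C> \<subseteq> U))"
    unfolding istopology_def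
  proof (rule conjI)
    show "\<forall>S T. S \<subseteq> X \<and> (\<forall>x\<in>S. \<exists>\<C>\<in>\<mu>. cover_star {x} \<C> \<subseteq> S) \<longrightarrow>
       T \<subseteq> X \<and> (\<forall>x\<in>T. \<exists>\<C>\<in>\<mu>. cover_star {x} \<C> \<subseteq> T) \<longrightarrow>
       S \<inter> T \<subseteq> X \<and> (\<forall>x\<in>S \<inter> T. \<exists>\<C>\<in>\<mu>. cover_star {x} \<C> \<subseteq> S \<inter> T)"
    proof (intro allI impI conjI ballI)
      fix S T x
      assume S: "S \<subseteq> X \<and> (\<forall>x\<in>S. \<exists>\<C>\<in>\<mu>. cover_star {x} \<C> \<subseteq> S)"
        and T: "T \<subseteq> X \<and> (\<forall>x\<in>T. \<exists>\<C>\<in>\<mu>. cover_star {x} \<C> \<subseteq> T)" and x: "x \<in> S \<inter> T"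
      obtain \<C> \<D> where CD: "\<C> \<in> \<mu>" "\<D> \<in> \<mu>" "cover_star {x} \<C> \<subseteq> S" "cover_star {x} \<D> \<subseteq> T"
        using S T x by blast
      then obtain \<E> where "\<E> \<in> \<mu>" "star_refines \<E> \<C>" "star_refines \<E> \<D>"
        using assms unfolding covering_uniformity_def by meson
      then show "\<exists>\<C>\<in>\<mu>. cover_star {x} \<C> \<subseteq> S \<inter> T"
        using sub[of \<E> \<C> x] sub[of \<E> \<D> x] CD by blast
    qed blast
    show "\<forall>\<K>. (\<forall>K\<in>\<K>. K \<subseteq> X \<and> (\<forall>x\<in>K. \<exists>\<C>\<in>\<mu>. cover_star {x} \<C> \<subseteq> K)) \<longrightarrow>
       \<Union> \<K> \<subseteq> X \<and> (\<forall>x\<in>\<Union> \<K>. \<exists>\<C>\<in>\<mu>. cover_star {x} \<C> \<subseteq> \<Union> \<K>)"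
      by (meson Sup_least Union_iff Union_upper subset_trans)
  qed
  then show ?thesis unfolding uniform_topology_def by (simp add: topology_inverse')
qed

end

(* Everything is transported from the Novak completion.  Cut at a base point, a point of the
   completion becomes an initial segment of X, and the circular order of the completion is the one
   induced by strict inclusion of these segments.  Segments have least upper bounds, so the completion
   is compact; it is Hausdorff as soon as there are three points, hence its only compatible uniformity
   consists of the covers refined by open covers.

   A star cover of X is the trace of the star cover of the same cycle in the completion, which is
   open.  Conversely, arcs with end points in X form a base of the completion, so every open cover is
   refined by finitely many of them; a cycle F through all their end points has no point between
   consecutive ones, so the arc (a_i, a_(i+2)) lies in any of these arcs which contains a_(i+1), and
   the star cover of F refines the given cover.  At most one point leaves only trivial uniformities. *)

theory Submission
  imports Defs
begin

section \<open>Uniform covers of compact Hausdorff spaces\<close>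

text \<open>The hypothesis on \<open>card X\<close> is forced. On two points the interval topology
  is discrete, but no cycle has three points, so \<open>star_uniformity\<close> is generated by
  \<open>{X}\<close> alone and its topology is indiscrete. From three points on, \<open>{X}\<close>
  is refined by a star cover.

  The delicate uniformity axiom for star covers is star refinement, and no star refinement of one
  star cover by another is ever constructed. The axiom holds for open covers of a compact Hausdorff
  space, passes to traces on \<open>X\<close>, and reaches \<open>star_uniformity\<close> through
  its equality with \<open>novak_uniformity\<close>. Only ordinary refinement between star covers
  and traces of open covers has to be checked.

  The base point is an artefact of cutting the circle: the circular order of the completion does not
  mention it, so each argument may cut where the situation is simplest.\<close>

definition open_cover_uniformity :: "'a topology \<Rightarrow> 'a set set set" where
  "open_cover_uniformity T = {\<C>. cover_of (topspace T) \<C> \<and>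
     (\<exists>\<V>. (\<forall>V\<in>\<V>. openin T V) \<and> \<Union>\<V> = topspace T \<and> cover_refines \<V> \<C>)}"

lemma open_cover_in_open_cover_uniformity:
  assumes "\<forall>V\<in>\<V>. openin T V" "\<Union>\<V> = topspace T"
  shows "\<V> \<in> open_cover_uniformity T"
  using assms unfolding open_cover_uniformity_def cover_of_def cover_refines_def by blast

lemma cover_refines_refl: "cover_refines \<C> \<C>"
  by (auto simp: cover_refines_def)

lemma cover_refines_trans:
  "cover_refines \<A> \<B> \<Longrightarrow> cover_refines \<B> \<C> \<Longrightarrow> cover_refines \<A> \<C>"
  unfolding cover_refines_def by (meson subset_trans)

lemma star_refines_imp_cover_refines:
  assumes "star_refines \<E> \<C>"
  shows "cover_refines \<E> \<C>"
  unfolding cover_refines_def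
proof
  fix A assume A: "A \<in> \<E>"
  then obtain B where B: "B \<in> \<C>" "cover_star A \<E> \<subseteq> B"
    using assms by (auto simp: star_refines_def)
  have "A \<subseteq> cover_star A \<E>" using A by (auto simp: cover_star_def)
  with B show "\<exists>B\<in>\<C>. A \<subseteq> B" by blast
qed

lemma star_refines_trans:
  assumes "star_refines \<E> \<D>" "cover_refines \<D> \<C>"
  shows "star_refines \<E> \<C>"
  using assms unfolding star_refines_def cover_refines_def by (meson subset_trans)

lemma refines_star_refines_trans:
  assumes "cover_refines \<E> \<D>" "star_refines \<D> \<C>"
  shows "star_refines \<E> \<C>"
  unfolding star_refines_def
proof
  fix A assume "A \<in> \<E>"
  then obtain B where B: "B \<in> \<D>" "A \<subseteq> B" using assms(1) by (auto simp: cover_refines_def)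
  then obtain C where C: "C \<in> \<C>" "cover_star B \<D> \<subseteq> C"
    using assms(2) by (auto simp: star_refines_def)
  have "cover_star A \<E> \<subseteq> cover_star B \<D>"
    unfolding cover_star_def using assms(1) B(2) by (fastforce simp: cover_refines_def)
  with C show "\<exists>C\<in>\<C>. cover_star A \<E> \<subseteq> C" by blast
qed

section \<open>Star refinements of open covers of a compact Hausdorff space\<close>

lemma compact_space_pointwise_cover:
  assumes "compact_space T" and G: "\<And>x. x \<in> topspace T \<Longrightarrow> openin T (G x) \<and> x \<in> G x"
  obtains P where "finite P" "P \<subseteq> topspace T" "topspace T \<subseteq> (\<Union>x\<in>P. G x)"
proof -
  have "(\<forall>U\<in>G ` topspace T. openin T U) \<and> topspace T \<subseteq> \<Union>(G ` topspace T)"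
    using G by blast
  then obtain \<F> where "finite \<F>" "\<F> \<subseteq> G ` topspace T" "topspace T \<subseteq> \<Union>\<F>"
    using assms(1)[unfolded compact_space_alt, rule_format, of "G ` topspace T"] by blast
  then show ?thesis using that by (metis finite_subset_image)
qed

text \<open>Regularity gives \<open>G x \<subseteq> K x \<subseteq> U x\<close> with
  \<open>K x\<close> closed, and finitely many \<open>G x\<close> cover. \<open>W y\<close> lies in
  each \<open>U x\<close> with \<open>y\<close> in \<open>K x\<close> and avoids every other
  \<open>K x\<close>. All \<open>W z\<close> through \<open>y\<close> then lie in the single set
  \<open>U x\<close> belonging to an \<open>x\<close> with \<open>y\<close> in
  \<open>G x\<close>.\<close>

lemma barycentric_refinement:
  assumes "compact_space T" "Hausdorff_space T"
    and "\<forall>U\<in>\<U>. openin T U" "\<Union>\<U> = topspace T"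
  obtains \<W> where "\<forall>W\<in>\<W>. openin T W" "\<Union>\<W> = topspace T"
    "\<And>y. y \<in> topspace T \<Longrightarrow> \<exists>U\<in>\<U>. cover_star {y} \<W> \<subseteq> U"
proof -
  have reg: "regular_space T"
    using assms(1,2) by (rule compact_Hausdorff_imp_regular_space)
  have "\<exists>G K U. openin T G \<and> closedin T K \<and> U \<in> \<U> \<and> x \<in> G \<and> G \<subseteq> K \<and> K \<subseteq> U"
    if x: "x \<in> topspace T" for x
  proof -
    obtain U where U: "U \<in> \<U>" "x \<in> U" using x assms(4) by blast
    then have "openin T U" using assms(3) by blast
    then obtain G K where "openin T G" "closedin T K" "x \<in> G" "G \<subseteq> K" "K \<subseteq> U"
      using reg U(2) unfolding neighbourhood_base_of_closedin[symmetric] neighbourhood_base_of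
      by metis
    then show ?thesis using U by blast
  qed
  then obtain G K U where GKU: "\<And>x. x \<in> topspace T \<Longrightarrow> openin T (G x) \<and> closedin T (K x) \<and>
      U x \<in> \<U> \<and> x \<in> G x \<and> G x \<subseteq> K x \<and> K x \<subseteq> U x"
    by metis
  obtain P where P: "finite P" "P \<subseteq> topspace T" "topspace T \<subseteq> (\<Union>x\<in>P. G x)"
    using compact_space_pointwise_cover[OF assms(1), of G] GKU by blast
  define W where "W y = (topspace T \<inter> \<Inter>{U x |x. x \<in> P \<and> y \<in> K x}) \<inter>
     (topspace T - \<Union>{K x |x. x \<in> P \<and> y \<notin> K x})" for y
  have opW: "openin T (W y)" for y
    unfolding W_def
  proof (rule openin_Int)
    have "finite {U x |x. x \<in> P \<and> y \<in> K x}" using P(1) by simp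
    moreover have "openin T V" if "V \<in> {U x |x. x \<in> P \<and> y \<in> K x}" for V
      using that GKU P(2) assms(3) by blast
    ultimately show "openin T (topspace T \<inter> \<Inter>{U x |x. x \<in> P \<and> y \<in> K x})"
      by (metis (no_types, lifting) openin_Inter openin_Int openin_topspace Inter_empty inf_top.right_neutral)
    have "finite {K x |x. x \<in> P \<and> y \<notin> K x}" using P(1) by simp
    moreover have "closedin T V" if "V \<in> {K x |x. x \<in> P \<and> y \<notin> K x}" for V
      using that GKU P(2) by blast
    ultimately show "openin T (topspace T - \<Union>{K x |x. x \<in> P \<and> y \<notin> K x})"
      by (intro openin_diff openin_topspace closedin_Union)
  qed
  have selfW: "y \<in> W y" if "y \<in> topspace T" for y
    using that P GKU unfolding W_def by blast
  have "\<exists>V\<in>\<U>. cover_star {y} (W ` topspace T) \<subseteq> V" if y: "y \<in> topspace T" for y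
  proof -
    obtain x where x: "x \<in> P" "y \<in> G x" using P(3) y by blast
    then have yK: "y \<in> K x" and xT: "x \<in> topspace T" using GKU P(2) by blast+
    have "W z \<subseteq> U x" if "y \<in> W z" for z
    proof -
      \<comment> \<open>Otherwise \<open>W z\<close> would avoid \<open>K x\<close>, which contains
        \<open>y\<close>.\<close>
      have "z \<in> K x" using that x yK unfolding W_def by blast
      then show ?thesis using x unfolding W_def by blast
    qed
    then have "cover_star {y} (W ` topspace T) \<subseteq> U x" by (auto simp: cover_star_def)
    then show ?thesis using GKU xT by blast
  qed
  moreover have "\<Union>(W ` topspace T) = topspace T"
    using selfW openin_subset[OF opW] by blast
  ultimately show ?thesis using opW that[of "W ` topspace T"] by blast
qed

text \<open>Two barycentric refinements in succession. Fix \<open>a\<close> in \<open>A\<close>; a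
  member \<open>A'\<close> meeting \<open>A\<close> at \<open>z\<close> lies together with
  \<open>A\<close> in one member of the intermediate cover, which therefore contains
  \<open>a\<close>. All such \<open>A'\<close> lie in the star of \<open>a\<close>, hence in one
  member of \<U>.\<close>

lemma open_star_refinement:
  assumes "compact_space T" "Hausdorff_space T" "topspace T \<noteq> {}"
    and "\<forall>U\<in>\<U>. openin T U" "\<Union>\<U> = topspace T"
  obtains \<W> where "\<forall>W\<in>\<W>. openin T W" "\<Union>\<W> = topspace T" "star_refines \<W> \<U>"
proof -
  obtain \<V> where V: "\<forall>V\<in>\<V>. openin T V" "\<Union>\<V> = topspace T"
      "\<And>y. y \<in> topspace T \<Longrightarrow> \<exists>U\<in>\<U>. cover_star {y} \<V> \<subseteq> U"
    using barycentric_refinement[OF assms(1,2,4,5)] by metis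
  obtain \<W> where W: "\<forall>V\<in>\<W>. openin T V" "\<Union>\<W> = topspace T"
      "\<And>y. y \<in> topspace T \<Longrightarrow> \<exists>U\<in>\<V>. cover_star {y} \<W> \<subseteq> U"
    using barycentric_refinement[OF assms(1,2) V(1,2)] by metis
  have "\<exists>U\<in>\<U>. cover_star A \<W> \<subseteq> U" if A: "A \<in> \<W>" for A
  proof (cases "A = {}")
    case True
    \<comment> \<open>An empty member still needs a member of \<U> to lie in; this is where
      nonemptiness of the space enters.\<close>
    moreover obtain U where "U \<in> \<U>" using assms(3,5) by blast
    ultimately show ?thesis by (auto simp: cover_star_def)
  next
    case False
    then obtain a where a: "a \<in> A" by blast
    then have "a \<in> topspace T" using A W(2) by blast
    then obtain U where U: "U \<in> \<U>" "cover_star {a} \<V> \<subseteq> U" using V(3) by blast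
    have "A' \<subseteq> U" if A': "A' \<in> \<W>" "A' \<inter> A \<noteq> {}" for A'
    proof -
      obtain z where z: "z \<in> A'" "z \<in> A" using A' by blast
      then have "z \<in> topspace T" using A W(2) by blast
      then obtain V where V: "V \<in> \<V>" "cover_star {z} \<W> \<subseteq> V" using W(3) by blast
      moreover have "A \<union> A' \<subseteq> cover_star {z} \<W>" using z A A' by (auto simp: cover_star_def)
      ultimately have "A' \<subseteq> V" "a \<in> V" using a by blast+
      then have "A' \<subseteq> cover_star {a} \<V>" using V(1) by (auto simp: cover_star_def)
      then show ?thesis using U by blast
    qed
    then have "cover_star A \<W> \<subseteq> U" by (auto simp: cover_star_def)
    then show ?thesis using U by blast
  qed
  then show ?thesis using W(1,2) that[of \<W>] unfolding star_refines_def by blast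
qed

lemma covering_uniformity_open_cover_uniformity:
  assumes "compact_space T" "Hausdorff_space T" "topspace T \<noteq> {}"
  shows "covering_uniformity (topspace T) (open_cover_uniformity T)"
  unfolding covering_uniformity_def
proof (intro conjI allI impI ballI)
  have "{topspace T} \<in> open_cover_uniformity T"
    by (intro open_cover_in_open_cover_uniformity) auto
  then show "open_cover_uniformity T \<noteq> {}" by blast
next
  fix \<C> assume "\<C> \<in> open_cover_uniformity T"
  then show "cover_of (topspace T) \<C>" by (simp add: open_cover_uniformity_def)
next
  fix \<C> \<D> assume "\<C> \<in> open_cover_uniformity T" "cover_of (topspace T) \<D>" "cover_refines \<C> \<D>"
  then show "\<D> \<in> open_cover_uniformity T"
    unfolding open_cover_uniformity_def mem_Collect_eq by (metis cover_refines_trans)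
next
  fix \<C> \<D> assume "\<C> \<in> open_cover_uniformity T" "\<D> \<in> open_cover_uniformity T"
  then obtain \<U> \<V> where U: "\<forall>V\<in>\<U>. openin T V" "\<Union>\<U> = topspace T" "cover_refines \<U> \<C>"
    and V: "\<forall>V\<in>\<V>. openin T V" "\<Union>\<V> = topspace T" "cover_refines \<V> \<D>"
    unfolding open_cover_uniformity_def mem_Collect_eq by metis
  define \<I> where "\<I> = {U \<inter> V |U V. U \<in> \<U> \<and> V \<in> \<V>}"
  have "\<forall>V\<in>\<I>. openin T V" using U(1) V(1) by (auto simp: \<I>_def)
  moreover have "\<Union>\<I> = topspace T"
  proof -
    have "\<Union>\<I> = \<Union>\<U> \<inter> \<Union>\<V>" unfolding \<I>_def by blast
    then show ?thesis using U(2) V(2) by simp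
  qed
  ultimately obtain \<W> where W: "\<forall>W\<in>\<W>. openin T W" "\<Union>\<W> = topspace T" "star_refines \<W> \<I>"
    by (rule open_star_refinement[OF assms])
  have "cover_refines \<I> \<U>" "cover_refines \<I> \<V>"
    unfolding cover_refines_def \<I>_def by blast+
  then have "cover_refines \<I> \<C>" "cover_refines \<I> \<D>"
    using U(3) V(3) cover_refines_trans by blast+
  then have "star_refines \<W> \<C>" "star_refines \<W> \<D>"
    using W(3) star_refines_trans by blast+
  moreover have "\<W> \<in> open_cover_uniformity T"
    using W(1,2) by (rule open_cover_in_open_cover_uniformity)
  ultimately show "\<exists>\<E>\<in>open_cover_uniformity T. star_refines \<E> \<C> \<and> star_refines \<E> \<D>" by blast
qed

lemma compatible_open_cover_uniformity:
  assumes "compact_space T" "Hausdorff_space T" "topspace T \<noteq> {}"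
  shows "compatible_uniformity T (open_cover_uniformity T)"
proof -
  note cu = covering_uniformity_open_cover_uniformity[OF assms]
  have "openin (uniform_topology (topspace T) (open_cover_uniformity T)) U \<longleftrightarrow> openin T U" for U
  proof
    assume "openin (uniform_topology (topspace T) (open_cover_uniformity T)) U"
    then have U: "U \<subseteq> topspace T" "\<And>x. x \<in> U \<Longrightarrow> \<exists>\<C>\<in>open_cover_uniformity T. cover_star {x} \<C> \<subseteq> U"
      using openin_uniform_topology[OF cu] by blast+
    have "\<exists>V. openin T V \<and> x \<in> V \<and> V \<subseteq> U" if x: "x \<in> U" for x
    proof -
      obtain \<C> \<V> where C: "cover_star {x} \<C> \<subseteq> U" and V: "\<forall>V\<in>\<V>. openin T V"
          "\<Union>\<V> = topspace T" "cover_refines \<V> \<C>"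
        using U(2)[OF x] unfolding open_cover_uniformity_def by blast
      then obtain V where "V \<in> \<V>" "x \<in> V" using U(1) x by blast
      moreover then obtain B where "B \<in> \<C>" "V \<subseteq> B" using V by (auto simp: cover_refines_def)
      moreover have "B \<subseteq> cover_star {x} \<C>" if "x \<in> B" using \<open>B \<in> \<C>\<close> that by (auto simp: cover_star_def)
      ultimately show ?thesis using C V(1) by blast
    qed
    then show "openin T U" by (subst openin_subopen) blast
  next
    assume U: "openin T U"
    have "\<exists>\<C>\<in>open_cover_uniformity T. cover_star {x} \<C> \<subseteq> U" if x: "x \<in> U" for x
    proof
      have xT: "x \<in> topspace T" using U x openin_subset by blast
      \<comment> \<open>In the cover by \<open>U\<close> and the complement of \<open>x\<close> only
        \<open>U\<close> contains \<open>x\<close>, so the star of \<open>x\<close> is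
        \<open>U\<close>. Points are closed because the space is Hausdorff.\<close>
      have "openin T (topspace T - {x})"
        using assms(2) xT by (simp add: closedin_Hausdorff_singleton openin_diff)
      then show "{U, topspace T - {x}} \<in> open_cover_uniformity T"
        using U x openin_subset[OF U] by (intro open_cover_in_open_cover_uniformity) auto
      show "cover_star {x} {U, topspace T - {x}} \<subseteq> U" by (auto simp: cover_star_def)
    qed
    then show "openin (uniform_topology (topspace T) (open_cover_uniformity T)) U"
      using openin_uniform_topology[OF cu] openin_subset[OF U] by blast
  qed
  then show ?thesis using cu unfolding compatible_uniformity_def by (simp add: topology_eq)
qed

section \<open>Uniqueness of the compatible uniformity of a compact space\<close>

lemma finite_common_star_refinement:
  assumes "covering_uniformity X \<mu>" "finite \<S>" "\<S> \<subseteq> \<mu>"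
  shows "\<exists>\<E>\<in>\<mu>. \<forall>\<D>\<in>\<S>. star_refines \<E> \<D>"
  using assms(2,3)
proof (induction \<S> rule: finite_induct)
  case empty
  then show ?case using assms(1) by (auto simp: covering_uniformity_def)
next
  case (insert \<C> \<S>)
  then obtain \<E> where E: "\<E> \<in> \<mu>" "\<forall>\<D>\<in>\<S>. star_refines \<E> \<D>" by blast
  have "\<C> \<in> \<mu>" using insert by blast
  with E(1) obtain \<G> where G: "\<G> \<in> \<mu>" "star_refines \<G> \<E>" "star_refines \<G> \<C>"
    using assms(1) unfolding covering_uniformity_def by meson
  then show ?case
    using refines_star_refines_trans[OF star_refines_imp_cover_refines[OF G(2)]] E(2) by blast
qed

text \<open>The interior of \<open>B\<close> for the uniform topology, phrased by stars of points;
  that it is open rests on star refinement.\<close>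

definition uniform_interior :: "'a set \<Rightarrow> 'a set set set \<Rightarrow> 'a set \<Rightarrow> 'a set" where
  "uniform_interior X \<mu> B = {x \<in> X. \<exists>\<D>\<in>\<mu>. cover_star {x} \<D> \<subseteq> B}"

lemma uniform_interior_subset:
  assumes "covering_uniformity X \<mu>"
  shows "uniform_interior X \<mu> B \<subseteq> B"
proof
  fix x assume "x \<in> uniform_interior X \<mu> B"
  then obtain \<D> where D: "x \<in> X" "\<D> \<in> \<mu>" "cover_star {x} \<D> \<subseteq> B"
    by (auto simp: uniform_interior_def)
  then have "\<Union>\<D> = X" using assms by (auto simp: covering_uniformity_def cover_of_def)
  then show "x \<in> B" using D by (auto simp: cover_star_def)
qed

text \<open>If \<E> star-refines \<D>, then for \<open>y\<close> in the \<E>-star of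
  \<open>x\<close> the \<E>-star of \<open>y\<close> lies in the \<D>-star of \<open>x\<close>,
  hence in \<open>B\<close>.\<close>

lemma openin_uniform_interior:
  assumes "covering_uniformity X \<mu>"
  shows "openin (uniform_topology X \<mu>) (uniform_interior X \<mu> B)"
  unfolding openin_uniform_topology[OF assms]
proof (intro conjI ballI)
  show "uniform_interior X \<mu> B \<subseteq> X" by (auto simp: uniform_interior_def)
  fix x assume "x \<in> uniform_interior X \<mu> B"
  then obtain \<D> where D: "x \<in> X" "\<D> \<in> \<mu>" "cover_star {x} \<D> \<subseteq> B"
    by (auto simp: uniform_interior_def)
  then obtain \<E> where E: "\<E> \<in> \<mu>" "star_refines \<E> \<D>"
    using assms unfolding covering_uniformity_def by meson
  have cov: "\<Union>\<E> = X" using assms E by (auto simp: covering_uniformity_def cover_of_def)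
  have "cover_star {x} \<E> \<subseteq> uniform_interior X \<mu> B"
  proof
    fix y assume "y \<in> cover_star {x} \<E>"
    then obtain A where A: "A \<in> \<E>" "x \<in> A" "y \<in> A" by (auto simp: cover_star_def)
    then obtain C where C: "C \<in> \<D>" "cover_star A \<E> \<subseteq> C"
      using E by (auto simp: star_refines_def)
    have "cover_star {y} \<E> \<subseteq> cover_star A \<E>" using A by (auto simp: cover_star_def)
    moreover have "x \<in> C" using A C by (auto simp: cover_star_def)
    moreover have "C \<subseteq> cover_star {x} \<D>" if "x \<in> C" using C that by (auto simp: cover_star_def)
    ultimately have "cover_star {y} \<E> \<subseteq> cover_star {x} \<D>" using C by blast
    then show "y \<in> uniform_interior X \<mu> B"
      using D(3) E(1) A cov by (auto simp: uniform_interior_def)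
  qed
  then show "\<exists>\<C>\<in>\<mu>. cover_star {x} \<C> \<subseteq> uniform_interior X \<mu> B" using E by blast
qed

text \<open>A uniform cover has an open refinement because the interiors of its members still cover:
  a star refinement puts a whole star of each point inside a member. Conversely an open cover is
  uniform by the Lebesgue number argument: finitely many star neighbourhoods cover, and a common
  refinement of the uniform covers attached to their centres refines the given cover.\<close>

lemma compatible_uniformity_unique:
  assumes "compact_space T" "topspace T \<noteq> {}" "compatible_uniformity T \<mu>"
  shows "\<mu> = open_cover_uniformity T"
proof
  define X where "X = topspace T"
  have cu: "covering_uniformity X \<mu>" and top: "uniform_topology X \<mu> = T"
    using assms(3) by (auto simp: compatible_uniformity_def X_def)
  have cov: "\<Union>\<C> = X" if "\<C> \<in> \<mu>" for \<C>
    using cu that by (auto simp: covering_uniformity_def cover_of_def)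
  have star: "\<exists>\<E>\<in>\<mu>. star_refines \<E> \<C>" if "\<C> \<in> \<mu>" for \<C>
    using cu that unfolding covering_uniformity_def by meson
  have opI: "openin T (uniform_interior X \<mu> B)" for B
    using openin_uniform_interior[OF cu] top by simp
  show "\<mu> \<subseteq> open_cover_uniformity T"
  proof
    fix \<C> assume C: "\<C> \<in> \<mu>"
    then obtain \<E> where E: "\<E> \<in> \<mu>" "star_refines \<E> \<C>" using star by blast
    have "\<exists>B\<in>\<C>. x \<in> uniform_interior X \<mu> B" if x: "x \<in> X" for x
    proof -
      obtain A where A: "A \<in> \<E>" "x \<in> A" using cov[OF E(1)] x by blast
      then obtain B where "B \<in> \<C>" "cover_star A \<E> \<subseteq> B" using E by (auto simp: star_refines_def)
      moreover have "cover_star {x} \<E> \<subseteq> cover_star A \<E>" using A by (auto simp: cover_star_def)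
      ultimately show ?thesis using x E(1) unfolding uniform_interior_def by blast
    qed
    then have "\<Union>(uniform_interior X \<mu> ` \<C>) = X"
      by (auto simp: uniform_interior_def)
    moreover have "cover_refines (uniform_interior X \<mu> ` \<C>) \<C>"
      using uniform_interior_subset[OF cu] by (auto simp: cover_refines_def)
    ultimately show "\<C> \<in> open_cover_uniformity T"
      unfolding open_cover_uniformity_def using opI cov[OF C] 
      by (auto simp: cover_of_def X_def intro!: exI[of _ "uniform_interior X \<mu> ` \<C>"])
  qed
  show "open_cover_uniformity T \<subseteq> \<mu>"
  proof
    fix \<C> assume "\<C> \<in> open_cover_uniformity T"
    then obtain \<U> where C: "cover_of X \<C>" and U: "\<forall>U\<in>\<U>. openin T U" "\<Union>\<U> = X" "cover_refines \<U> \<C>"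
      by (auto simp: open_cover_uniformity_def X_def)
    have "\<exists>U \<C> \<D>. U \<in> \<U> \<and> \<C> \<in> \<mu> \<and> \<D> \<in> \<mu> \<and> cover_star {x} \<C> \<subseteq> U \<and> star_refines \<D> \<C>"
      if x: "x \<in> X" for x
    proof -
      obtain U where U': "U \<in> \<U>" "x \<in> U" using x U(2) by blast
      then have "openin (uniform_topology X \<mu>) U" using U(1) top by simp
      then obtain \<C> where "\<C> \<in> \<mu>" "cover_star {x} \<C> \<subseteq> U"
        using U' openin_uniform_topology[OF cu] by blast
      then show ?thesis using U' star by blast
    qed
    then obtain U \<G> \<D> where UCD: "\<And>x. x \<in> X \<Longrightarrow> U x \<in> \<U> \<and> \<G> x \<in> \<mu> \<and> \<D> x \<in> \<mu> \<and>
        cover_star {x} (\<G> x) \<subseteq> U x \<and> star_refines (\<D> x) (\<G> x)"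
      by metis
    define I where "I x = uniform_interior X \<mu> (cover_star {x} (\<D> x))" for x
    have "x \<in> I x" if "x \<in> X" for x
      using that UCD unfolding I_def uniform_interior_def by blast
    then have "openin T (I x) \<and> x \<in> I x" if "x \<in> topspace T" for x
      using that opI by (simp add: I_def X_def)
    then obtain P where P: "finite P" "P \<subseteq> X" "X \<subseteq> (\<Union>x\<in>P. I x)"
      unfolding X_def by (rule compact_space_pointwise_cover[OF assms(1)])
    have "finite (\<D> ` P)" "\<D> ` P \<subseteq> \<mu>" using P(1,2) UCD by auto
    then obtain \<E> where E: "\<E> \<in> \<mu>" "\<And>x. x \<in> P \<Longrightarrow> star_refines \<E> (\<D> x)"
      using finite_common_star_refinement[OF cu, of "\<D> ` P"] by blast
    have "\<exists>U\<in>\<U>. A \<subseteq> U" if A: "A \<in> \<E>" for A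
    proof (cases "A = {}")
      case True
      then show ?thesis using U(2) assms(2) X_def by blast
    next
      case False
      then obtain a where a: "a \<in> A" by blast
      then have "a \<in> X" using cov[OF E(1)] A by blast
      then obtain x where x: "x \<in> P" "a \<in> I x" using P(3) by blast
      then have xX: "x \<in> X" using P by blast
      have "a \<in> cover_star {x} (\<D> x)"
        using x(2) uniform_interior_subset[OF cu] unfolding I_def by blast
      then obtain D where D: "D \<in> \<D> x" "x \<in> D" "a \<in> D" by (auto simp: cover_star_def)
      obtain D' where D': "D' \<in> \<D> x" "A \<subseteq> D'"
        using star_refines_imp_cover_refines[OF E(2)[OF x(1)]] A by (auto simp: cover_refines_def)
      \<comment> \<open>\<open>D'\<close> contains \<open>A\<close> and hence \<open>a\<close>, so
        it meets \<open>D\<close>; both lie in one member of \<open>\<G> x\<close> through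
        \<open>x\<close>, and the star of \<open>x\<close> in \<open>\<G> x\<close> is inside
        \<open>U x\<close>.\<close>
      obtain C where C: "C \<in> \<G> x" "cover_star D (\<D> x) \<subseteq> C"
        using UCD[OF xX] D(1) by (auto simp: star_refines_def)
      have "D' \<subseteq> C" "x \<in> C" using C(2) D D' a by (auto simp: cover_star_def)
      then have "A \<subseteq> U x" using UCD[OF xX] C(1) D'(2) by (auto simp: cover_star_def)
      then show ?thesis using UCD[OF xX] by blast
    qed
    then have "cover_refines \<E> \<U>" by (simp add: cover_refines_def)
    then have "cover_refines \<E> \<C>" using U(3) cover_refines_trans by blast
    then show "\<C> \<in> \<mu>" using cu E(1) C unfolding covering_uniformity_def by blast
  qed
qed

lemma the_compatible_uniformity:
  assumes "compact_space T" "Hausdorff_space T" "topspace T \<noteq> {}"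
  shows "(THE \<mu>. compatible_uniformity T \<mu>) = open_cover_uniformity T"
  using compatible_open_cover_uniformity[OF assms] compatible_uniformity_unique[OF assms(1,3)]
  by (rule the_equality)

text \<open>Traces that meet come from members that meet, so taking traces preserves star
  refinement.\<close>

lemma covering_uniformity_induced:
  assumes "covering_uniformity Y \<mu>" "f ` X \<subseteq> Y"
  shows "covering_uniformity X (induced_uniformity X f \<mu>)"
proof -
  let ?tr = "\<lambda>\<V>. (\<lambda>V. f -` V \<inter> X) ` \<V>"
  have tr: "?tr \<V> \<in> induced_uniformity X f \<mu>" if "\<V> \<in> \<mu>" for \<V>
  proof -
    have "\<Union>\<V> = Y" using that assms(1) by (auto simp: covering_uniformity_def cover_of_def)
    then have "cover_of X (?tr \<V>)" using assms(2) by (fastforce simp: cover_of_def)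
    moreover have "cover_refines (?tr \<V>) (?tr \<V>)" by (auto simp: cover_refines_def)
    ultimately show ?thesis using that by (auto simp: induced_uniformity_def)
  qed
  have star: "star_refines (?tr \<E>) (?tr \<V>)" if "star_refines \<E> \<V>" for \<E> \<V>
    unfolding star_refines_def
  proof
    fix A assume "A \<in> ?tr \<E>"
    then obtain E where E: "E \<in> \<E>" "A = f -` E \<inter> X" by blast
    then obtain V where V: "V \<in> \<V>" "cover_star E \<E> \<subseteq> V"
      using \<open>star_refines \<E> \<V>\<close> unfolding star_refines_def by blast
    have "cover_star A (?tr \<E>) \<subseteq> f -` cover_star E \<E> \<inter> X"
      unfolding E(2) cover_star_def by blast
    also have "\<dots> \<subseteq> f -` V \<inter> X" using V(2) by blast
    finally show "\<exists>B\<in>?tr \<V>. cover_star A (?tr \<E>) \<subseteq> B" using V(1) by (rule bexI[OF _ imageI])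
  qed
  show ?thesis
    unfolding covering_uniformity_def
  proof (intro conjI allI impI ballI)
    show "induced_uniformity X f \<mu> \<noteq> {}"
      using tr assms(1) unfolding covering_uniformity_def by blast
  next
    fix \<C> assume "\<C> \<in> induced_uniformity X f \<mu>"
    then show "cover_of X \<C>" by (simp add: induced_uniformity_def)
  next
    fix \<C> \<D> assume "\<C> \<in> induced_uniformity X f \<mu>" "cover_of X \<D>" "cover_refines \<C> \<D>"
    then show "\<D> \<in> induced_uniformity X f \<mu>"
      unfolding induced_uniformity_def using cover_refines_trans by blast
  next
    fix \<C> \<D> assume "\<C> \<in> induced_uniformity X f \<mu>" "\<D> \<in> induced_uniformity X f \<mu>"
    then obtain \<U> \<V> where "\<U> \<in> \<mu>" "\<V> \<in> \<mu>" and ref: "cover_refines (?tr \<U>) \<C>" "cover_refines (?tr \<V>) \<D>"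
      unfolding induced_uniformity_def by blast
    then obtain \<E> where E: "\<E> \<in> \<mu>" "star_refines \<E> \<U>" "star_refines \<E> \<V>"
      using assms(1) unfolding covering_uniformity_def by meson
    show "\<exists>\<E>\<in>induced_uniformity X f \<mu>. star_refines \<E> \<C> \<and> star_refines \<E> \<D>"
      using tr[OF E(1)] star_refines_trans[OF star[OF E(2)] ref(1)]
        star_refines_trans[OF star[OF E(3)] ref(2)] by blast
  qed
qed

section \<open>Arcs, cycles and star covers in a circular order\<close>

locale circ_order =
  fixes X :: "'a set" and R :: "('a \<times> 'a \<times> 'a) set"
  assumes circ: "circular_order_on X R"
begin

lemma in_X: "(a, b, c) \<in> R \<Longrightarrow> a \<in> X \<and> b \<in> X \<and> c \<in> X"
  using circ[unfolded circular_order_on_def, THEN conjunct1] by blast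

lemma rot: "(a, b, c) \<in> R \<Longrightarrow> (b, c, a) \<in> R"
  by (rule circ[unfolded circular_order_on_def, THEN conjunct2, THEN conjunct1, rule_format])

lemma rot2: "(a, b, c) \<in> R \<Longrightarrow> (c, a, b) \<in> R"
  using rot by blast

lemma asym: "(a, b, c) \<in> R \<Longrightarrow> (c, b, a) \<notin> R"
  by (rule circ[unfolded circular_order_on_def, THEN conjunct2, THEN conjunct2, THEN conjunct1,
        rule_format])

lemma tr: "(a, b, c) \<in> R \<Longrightarrow> (a, c, d) \<in> R \<Longrightarrow> (a, b, d) \<in> R"
  by (rule circ[unfolded circular_order_on_def, THEN conjunct2, THEN conjunct2, THEN conjunct2,
        THEN conjunct1, rule_format])

lemma tot:
  assumes "a \<in> X" "b \<in> X" "c \<in> X" "a \<noteq> b" "b \<noteq> c" "a \<noteq> c"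
  shows "(a, b, c) \<in> R \<or> (a, c, b) \<in> R"
  using circ[unfolded circular_order_on_def, THEN conjunct2, THEN conjunct2, THEN conjunct2,
      THEN conjunct2] assms by simp

lemma neqs: "(a, b, c) \<in> R \<Longrightarrow> a \<noteq> b \<and> b \<noteq> c \<and> a \<noteq> c"
  using asym rot by metis

lemma not_refl [simp]: "(a, a, b) \<notin> R" "(a, b, b) \<notin> R" "(a, b, a) \<notin> R"
  using neqs by blast+

lemma asym': "(a, b, c) \<in> R \<Longrightarrow> (a, c, b) \<notin> R"
  using asym rot by metis

text \<open>If the circle is cut at \<open>x\<close>, \<open>tr\<close> is transitivity of the
  resulting linear order and this is its cut property. Most arc computations below combine the two
  with rotations.\<close>

lemma tr': "(x, a, b) \<in> R \<Longrightarrow> (x, b, c) \<in> R \<Longrightarrow> (a, b, c) \<in> R"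
  using tr rot by metis

lemma open_arc_iff [simp]: "y \<in> open_arc R a b \<longleftrightarrow> (a, y, b) \<in> R"
  by (simp add: open_arc_def)

lemma open_arc_subset: "open_arc R a b \<subseteq> X"
  using in_X by auto

text \<open>For \<open>a = b\<close> the left side is empty and the right side lacks only one point;
  this causes the later case splits on equal end points.\<close>

lemma open_arc_eq_compl:
  assumes "a \<in> X" "b \<in> X" "a \<noteq> b"
  shows "open_arc R a b = X - closed_arc R b a"
proof -
  have "(a, y, b) \<in> R \<longleftrightarrow> (b, y, a) \<notin> R \<and> y \<noteq> a \<and> y \<noteq> b" if "y \<in> X" for y
    using asym[of a y b] neqs[of a y b] tot[of a y b] rot[of a b y] assms that by (metis rot)
  then show ?thesis using in_X by (auto simp: closed_arc_def)
qed

lemma topspace_interval: "topspace (interval_topology X R) = X"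
  unfolding interval_topology_def topology_generated_by_topspace
  by (auto simp: interval_base_def)

lemma openin_compl_closed_arc:
  assumes "a \<in> X" "b \<in> X"
  shows "openin (interval_topology X R) (X - closed_arc R a b)"
  unfolding interval_topology_def
  by (rule topology_generated_by_Basis) (use assms in \<open>auto simp: interval_base_def\<close>)

lemma openin_open_arc:
  assumes "a \<in> X" "b \<in> X"
  shows "openin (interval_topology X R) (open_arc R a b)"
proof (cases "a = b")
  case True
  then have "open_arc R a b = {}" using neqs by auto
  then show ?thesis by simp
next
  case False
  then show ?thesis using openin_compl_closed_arc[of b a] assms by (simp add: open_arc_eq_compl)
qed

lemma open_basic_nbhd:
  assumes "openin (interval_topology X R) U" "x \<in> U" "a \<in> X" "x \<noteq> a"
  obtains c d where "c \<in> X" "d \<in> X" "x \<notin> closed_arc R c d" "X - closed_arc R c d \<subseteq> U"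
proof -
  obtain V where V: "V \<in> interval_base X R" "x \<in> V" "V \<subseteq> U"
    using assms(1,2) unfolding openin_interval_topology[OF circ] arbitrary_union_of_alt by metis
  show thesis
  proof (cases "V = X")
    case True
    have "x \<notin> closed_arc R a a" using assms(4) neqs by (auto simp: closed_arc_def)
    then show ?thesis using that[OF assms(3,3)] True V(3) by blast
  next
    case False
    then obtain c d where "c \<in> X" "d \<in> X" "V = X - closed_arc R c d"
      using V(1) by (auto simp: interval_base_def)
    then show ?thesis using that V by blast
  qed
qed

text \<open>A complement of a single point \<open>c\<close> is not an open arc. Two points besides
  \<open>x\<close> guarantee some \<open>e\<close> different from \<open>c\<close> and
  \<open>x\<close>, and one of the two arcs between \<open>c\<close> and \<open>e\<close> contains
  \<open>x\<close>.\<close>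

lemma open_arc_nbhd:
  assumes "openin (interval_topology X R) U" "x \<in> U"
    and "a \<in> X" "b \<in> X" "x \<noteq> a" "x \<noteq> b" "a \<noteq> b"
  obtains c d where "(c, x, d) \<in> R" "open_arc R c d \<subseteq> U"
proof -
  have xX: "x \<in> X" using assms(1,2) topspace_interval openin_subset by blast
  obtain c d where cd: "c \<in> X" "d \<in> X" "x \<notin> closed_arc R c d" "X - closed_arc R c d \<subseteq> U"
    using open_basic_nbhd[OF assms(1-3,5)] by blast
  have x: "x \<noteq> c" "x \<noteq> d" using cd(3) by (auto simp: closed_arc_def)
  show thesis
  proof (cases "c = d")
    case False
    then have "open_arc R d c = X - closed_arc R c d" using open_arc_eq_compl cd by blast
    then show ?thesis using that[of d c] cd xX by (metis DiffI open_arc_iff)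
  next
    case True
    obtain e where e: "e \<in> X" "e \<noteq> x" "e \<noteq> c" using assms(3-7) by metis
    have "X - {c} \<subseteq> U" using cd(4) True by (auto simp: closed_arc_def)
    moreover have "c \<notin> open_arc R c e" "c \<notin> open_arc R e c" by simp_all
    ultimately have arc: "open_arc R c e \<subseteq> U" "open_arc R e c \<subseteq> U"
      using open_arc_subset by blast+
    have "(c, x, e) \<in> R \<or> (e, x, c) \<in> R" using tot[of c x e] rot xX e x cd(1) by metis
    then show ?thesis using that arc by blast
  qed
qed

text \<open>A third point \<open>c\<close> on the arc from \<open>b\<close> to \<open>a\<close>
  serves as one separating end. If some \<open>d\<close> lies on the arc from \<open>a\<close> to
  \<open>b\<close>, the two arcs between \<open>c\<close> and \<open>d\<close> separate. If that arc
  is empty, \<open>(a, c)\<close> and \<open>(c, b)\<close> separate, because their intersection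
  would lie in it.\<close>

lemma Hausdorff_interval:
  assumes three: "\<And>a b. a \<in> X \<Longrightarrow> b \<in> X \<Longrightarrow> \<exists>c\<in>X. c \<noteq> a \<and> c \<noteq> b"
  shows "Hausdorff_space (interval_topology X R)"
proof -
  have main: "\<exists>U V. openin (interval_topology X R) U \<and> openin (interval_topology X R) V \<and>
      a \<in> U \<and> b \<in> V \<and> disjnt U V"
    if abc: "(b, c, a) \<in> R" for a b c
  proof (cases "open_arc R a b = {}")
    case True
    have "(a, y, b) \<in> R" if "(c, y, b) \<in> R" "(a, y, c) \<in> R" for y
      using rot2[OF that(2)] that(1) by (rule tr')
    then have "open_arc R c b \<inter> open_arc R a c = {}" using True by (metis disjoint_iff open_arc_iff empty_iff)
    moreover have "a \<in> open_arc R c b" "b \<in> open_arc R a c"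
      using rot[OF abc] rot2[OF abc] by simp_all
    ultimately show ?thesis using openin_open_arc in_X[OF abc] unfolding disjnt_def by meson
  next
    case False
    then obtain d where d: "(a, d, b) \<in> R" by auto
    have "(a, b, c) \<in> R" using abc by (rule rot2)
    then have "(d, b, c) \<in> R" "(a, d, c) \<in> R" using d by (blast intro: tr tr')+
    then have "(c, a, d) \<in> R" "(d, b, c) \<in> R" by (blast intro: rot2)+
    moreover have "open_arc R c d \<inter> open_arc R d c = {}" using asym by auto
    ultimately show ?thesis using openin_open_arc in_X[OF abc] in_X[OF d]
      unfolding disjnt_def by (metis open_arc_iff)
  qed
  show ?thesis
    unfolding Hausdorff_space_def topspace_interval
  proof (intro allI impI, elim conjE)
    fix a b assume ab: "a \<in> X" "b \<in> X" "a \<noteq> b"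
    then obtain c where c: "c \<in> X" "c \<noteq> a" "c \<noteq> b" using three by blast
    then consider "(b, c, a) \<in> R" | "(a, c, b) \<in> R" using tot[of b c a] ab rot by metis
    then show "\<exists>U V. openin (interval_topology X R) U \<and> openin (interval_topology X R) V \<and>
      a \<in> U \<and> b \<in> V \<and> disjnt U V"
    proof cases
      case 1
      then show ?thesis by (rule main)
    next
      case 2
      then show ?thesis using main[of a c b] by (metis disjnt_sym)
    qed
  qed
qed

text \<open>The points of the arc are linearly ordered as seen from \<open>p\<close>; the closed arc
  from the earlier to the later of two points stays inside.\<close>

lemma circ_convex_open_arc: "circ_convex X R (open_arc R p q)"
proof -
  have "closed_arc R a b \<subseteq> open_arc R p q" if "(p, a, b) \<in> R" "(p, b, q) \<in> R" for a b
  proof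
    fix y assume "y \<in> closed_arc R a b"
    then consider "y = a" | "y = b" | "(a, y, b) \<in> R" by (auto simp: closed_arc_def)
    then show "y \<in> open_arc R p q"
    proof cases
      case 3
      then have "(p, y, b) \<in> R" using that(1) rot tr by metis
      then show ?thesis using that(2) tr by auto
    qed (use that tr in auto)
  qed
  moreover have "closed_arc R a a \<subseteq> open_arc R p q" if "(p, a, q) \<in> R" for a
    using that by (auto simp: closed_arc_def)
  ultimately show ?thesis
    unfolding circ_convex_def using open_arc_subset tot in_X neqs open_arc_iff by metis
qed

section \<open>Finite cycles and their star covers\<close>

lemma cycle_in_next:
  assumes "cycle_in X R F" "i < length F" "j < length F" "j \<noteq> i" "j \<noteq> (i + 1) mod length F"
  shows "(F ! i, F ! ((i + 1) mod length F), F ! j) \<in> R"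
proof (cases "i + 1 < length F")
  case True
  then show ?thesis using assms unfolding cycle_in_def
    by (metis add.commute less_add_one linorder_neqE_nat mod_less nat_less_le plus_1_eq_Suc
        not_less_eq)
next
  case False
  then have "i = length F - 1" "i + 1 = length F" using assms(2) by auto
  then have "(i + 1) mod length F = 0" by simp
  then show ?thesis using assms \<open>i = length F - 1\<close> unfolding cycle_in_def
    by (metis Suc_diff_1 gr0I le_less_Suc_eq less_nat_zero_code linorder_not_le not_less_eq)
qed

lemma cycle_in_next2:
  assumes "cycle_in X R F" "i < length F" "3 \<le> length F"
  shows "(F ! i, F ! ((i + 1) mod length F), F ! ((i + 2) mod length F)) \<in> R"
proof -
  have "(i + 2) mod length F < length F" using assms(2) by (intro mod_less_divisor) linarith
  moreover have "(i + 2) mod length F \<noteq> i" "(i + 2) mod length F \<noteq> (i + 1) mod length F"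
    using assms(2,3) by (cases "i + 2 < length F"; cases "i + 1 < length F"; force simp: le_mod_geq)+
  ultimately show ?thesis using cycle_in_next assms by blast
qed

lemma finite_has_last:
  assumes "finite A" "A \<noteq> {}" "A \<subseteq> X - {x}" "x \<in> X"
  shows "\<exists>m\<in>A. \<forall>a\<in>A. a = m \<or> (x, a, m) \<in> R"
  using assms
proof (induction A rule: finite_ne_induct)
  case (insert b A)
  then obtain m where m: "m \<in> A" "\<forall>a\<in>A. a = m \<or> (x, a, m) \<in> R" by blast
  then have "(x, b, m) \<in> R \<or> (x, m, b) \<in> R" using tot[of x b m] insert by blast
  then show ?case
  proof
    assume "(x, b, m) \<in> R"
    then show ?thesis using m by blast
  next
    assume "(x, m, b) \<in> R"
    then have "\<forall>a\<in>insert b A. a = b \<or> (x, a, b) \<in> R" using m(2) tr by (metis insert_iff)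
    then show ?thesis by blast
  qed
qed blast

text \<open>A point of the cycle is the middle of the arc that starts at its predecessor. A point
  \<open>x\<close> outside the cycle lies between two consecutive points: the last entry met when
  going round from \<open>x\<close>, and its successor.\<close>

lemma Union_star_cover:
  assumes "cycle_in X R F" "3 \<le> length F"
  shows "\<Union>(star_cover R F) = X"
proof
  show "\<Union>(star_cover R F) \<subseteq> X" using open_arc_subset by (auto simp: star_cover_def)
  show "X \<subseteq> \<Union>(star_cover R F)"
  proof
    fix x assume x: "x \<in> X"
    let ?n = "length F"
    have "\<exists>i<?n. (F ! i, x, F ! ((i + 2) mod ?n)) \<in> R"
    proof (cases "x \<in> set F")
      case True
      then obtain k where k: "k < ?n" "x = F ! k" by (auto simp: in_set_conv_nth)
      \<comment> \<open>The cyclic predecessor of \<open>k\<close>; adding the length avoids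
        truncated subtraction at \<open>k = 0\<close>.\<close>
      define i where "i = (k + ?n - 1) mod ?n"
      have "i < ?n" using k(1) unfolding i_def by (intro mod_less_divisor) linarith
      moreover have "(i + 1) mod ?n = k"
      proof (cases "k = 0")
        case True
        then show ?thesis using k(1) by (simp add: i_def)
      next
        case False
        then have "k + ?n - 1 = (k - 1) + ?n" by simp
        then have "i = k - 1" using k(1) unfolding i_def by (simp only: mod_add_self2) simp
        then show ?thesis using k(1) False by simp
      qed
      ultimately show ?thesis using cycle_in_next2[OF assms(1) _ assms(2), of i] k by auto
    next
      case False
      then have "\<exists>m\<in>set F. \<forall>a\<in>set F. a = m \<or> (x, a, m) \<in> R"
        using assms x by (intro finite_has_last) (auto simp: cycle_in_def)
      then obtain i where i: "i < ?n" "\<forall>a\<in>set F. a = F ! i \<or> (x, a, F ! i) \<in> R"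
        by (auto simp: in_set_conv_nth)
      let ?j = "(i + 1) mod ?n"
      note n2 = cycle_in_next2[OF assms(1) i(1) assms(2)]
      have "?j < ?n" using i(1) by (intro mod_less_divisor) linarith
      then have "(x, F ! ?j, F ! i) \<in> R" using i(2) neqs[OF n2] by (metis nth_mem)
      then have "(F ! i, x, F ! ?j) \<in> R" using rot by blast
      then show ?thesis using tr n2 i(1) by blast
    qed
    then show "x \<in> \<Union>(star_cover R F)" by (auto simp: star_cover_def)
  qed
qed

text \<open>No point of the cycle lies strictly between two consecutive ones, so an arc with end points
  in the cycle which contains the middle point \<open>F ! (i + 1)\<close> contains the whole arc.\<close>

lemma star_cover_arc_subset:
  assumes "cycle_in X R F" "3 \<le> length F" "i < length F"
    and "p \<in> set F" "q \<in> set F" and pmq: "(p, F ! ((i + 1) mod length F), q) \<in> R"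
  shows "open_arc R (F ! i) (F ! ((i + 2) mod length F)) \<subseteq> open_arc R p q"
proof -
  let ?n = "length F"
  define a m b where "a = F ! i" and "m = F ! ((i + 1) mod ?n)" and "b = F ! ((i + 2) mod ?n)"
  have amb: "(a, m, b) \<in> R" using cycle_in_next2[OF assms(1,3,2)] by (simp add: a_def m_def b_def)
  have pmq: "(p, m, q) \<in> R" using pmq by (simp add: m_def)
  have p: "p = a \<or> (a, m, p) \<in> R"
  proof -
    obtain j where "j < ?n" "p = F ! j" using assms(4) by (auto simp: in_set_conv_nth)
    then show ?thesis using cycle_in_next[OF assms(1,3), of j] neqs[OF pmq]
      by (auto simp: a_def m_def)
  qed
  have q: "q = b \<or> (m, b, q) \<in> R"
  proof -
    obtain j where j: "j < ?n" "q = F ! j" using assms(5) by (auto simp: in_set_conv_nth)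
    have "(i + 1) mod ?n < ?n" using j(1) by (intro mod_less_divisor) linarith
    moreover have "((i + 1) mod ?n + 1) mod ?n = (i + 2) mod ?n" by (simp add: mod_Suc_eq)
    ultimately show ?thesis using cycle_in_next[OF assms(1), of "(i + 1) mod ?n" j] neqs[OF pmq] j
      by (auto simp: b_def m_def)
  qed
  have mqp: "(m, q, p) \<in> R" using pmq by (rule rot)
  have "(p, y, q) \<in> R" if y: "(a, y, b) \<in> R" for y
  proof -
    \<comment> \<open>Split the arc at \<open>m\<close>: the half behind \<open>m\<close> is bounded
      by \<open>q\<close>, the half before \<open>m\<close> by \<open>p\<close>.\<close>
    consider "y = m" | "(a, m, y) \<in> R" | "(a, y, m) \<in> R"
      using tot[of a m y] neqs[OF y] neqs[OF amb] in_X[OF y] in_X[OF amb] by blast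
    then show ?thesis
    proof cases
      case 1
      then show ?thesis using pmq by simp
    next
      case 2
      then have "(m, y, b) \<in> R" using y by (rule tr')
      then have "(m, y, q) \<in> R" using q tr by blast
      then show ?thesis using mqp by (blast intro: rot2 tr')
    next
      case 3
      then have "(m, a, y) \<in> R" by (rule rot2)
      moreover have "p = a \<or> (m, p, a) \<in> R" using p rot by blast
      ultimately have "(m, p, y) \<in> R" using tr by blast
      with mqp have "(q, p, y) \<in> R" by (rule tr')
      then show ?thesis by (rule rot)
    qed
  qed
  then show ?thesis by (auto simp: a_def b_def)
qed

lemma finite_sorted_from:
  assumes "finite A" "A \<subseteq> X - {x}" "x \<in> X"
  shows "\<exists>xs. set xs = A \<and> sorted_wrt (\<lambda>a b. (x, a, b) \<in> R) xs"
  using assms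
proof (induction "card A" arbitrary: A)
  case 0
  then show ?case by auto
next
  case (Suc n)
  then have "A \<noteq> {}" by auto
  then obtain m where m: "m \<in> A" "\<forall>a\<in>A. a = m \<or> (x, a, m) \<in> R"
    using finite_has_last[of A x] Suc by blast
  have "n = card (A - {m})" "finite (A - {m})" "A - {m} \<subseteq> X - {x}"
    using Suc m by auto
  then obtain xs where "set xs = A - {m}" "sorted_wrt (\<lambda>a b. (x, a, b) \<in> R) xs"
    using Suc by blast
  then have "set (xs @ [m]) = A" "sorted_wrt (\<lambda>a b. (x, a, b) \<in> R) (xs @ [m])"
    using m by (auto simp: sorted_wrt_append)
  then show ?case by blast
qed

text \<open>Sort the points as seen from one of them. Increasing triples then lie in
  \<open>R\<close> by \<open>tr'\<close>, and the other two cyclic index patterns are rotations of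
  these.\<close>

lemma finite_cycle:
  assumes "finite P" "P \<subseteq> X" "P \<noteq> {}"
  obtains F where "cycle_in X R F" "set F = P"
proof -
  obtain x where x: "x \<in> P" using assms(3) by blast
  then obtain xs where xs: "set xs = P - {x}" "sorted_wrt (\<lambda>a b. (x, a, b) \<in> R) xs"
    using finite_sorted_from[of "P - {x}" x] assms by blast
  let ?F = "x # xs"
  have sw: "(x, xs ! i, xs ! j) \<in> R" if "i < j" "j < length xs" for i j
    using xs(2) that by (simp add: sorted_wrt_iff_nth_less)
  have "xs ! i \<noteq> xs ! j" if "i < length xs" "j < length xs" "i \<noteq> j" for i j
    using sw[of i j] sw[of j i] that neqs by (metis linorder_neqE_nat)
  then have dist: "distinct ?F" using xs(1) distinct_conv_nth[of xs] by simp
  have inc: "(?F ! i, ?F ! j, ?F ! k) \<in> R" if ijk: "i < j" "j < k" "k < length ?F" for i j k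
  proof -
    define j' k' where "j' = j - 1" and "k' = k - 1"
    then have jk: "j = Suc j'" "k = Suc k'" using ijk by simp_all
    then have xjk: "(x, xs ! j', xs ! k') \<in> R" using sw ijk by simp
    show ?thesis
    proof (cases i)
      case 0
      then show ?thesis using xjk jk by simp
    next
      case (Suc i')
      then have "(x, xs ! i', xs ! j') \<in> R" using sw ijk jk by simp
      then show ?thesis using tr'[OF _ xjk] Suc jk by simp
    qed
  qed
  have "cycle_in X R ?F"
    unfolding cycle_in_def
  proof (intro conjI allI impI)
    show "set ?F \<subseteq> X" using xs(1) x assms(2) by auto
    show "distinct ?F" by (rule dist)
    fix i j k assume *: "i < length ?F" "j < length ?F" "k < length ?F"
      "i < j \<and> j < k \<or> j < k \<and> k < i \<or> k < i \<and> i < j"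
    then show "(?F ! i, ?F ! j, ?F ! k) \<in> R"
      using inc[of i j k] inc[of j k i] inc[of k i j] rot by blast
  qed
  moreover have "set ?F = P" using xs(1) x by auto
  ultimately show thesis using that by blast
qed

lemma cycle_in_length:
  assumes "cycle_in X R F"
  shows "length F = card (set F)"
  using assms by (simp add: cycle_in_def distinct_card)

end

section \<open>Circular orders obtained from linear orders\<close>

definition circ_of :: "'a set \<Rightarrow> ('a \<Rightarrow> 'a \<Rightarrow> bool) \<Rightarrow> ('a \<times> 'a \<times> 'a) set" where
  "circ_of Y lt = {(a, b, c). a \<in> Y \<and> b \<in> Y \<and> c \<in> Y \<and>
     (lt a b \<and> lt b c \<or> lt b c \<and> lt c a \<or> lt c a \<and> lt a b)}"

text \<open>Only totality is relative to \<open>Y\<close>: the intended \<open>lt\<close> is strict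
  inclusion of encoding segments, which is irreflexive and transitive for all relations but total
  only on points of the completion.\<close>

locale strict_linear =
  fixes Y :: "'a set" and lt :: "'a \<Rightarrow> 'a \<Rightarrow> bool"
  assumes irr: "\<not> lt a a"
    and trans: "lt a b \<Longrightarrow> lt b c \<Longrightarrow> lt a c"
    and total: "a \<in> Y \<Longrightarrow> b \<in> Y \<Longrightarrow> a \<noteq> b \<Longrightarrow> lt a b \<or> lt b a"
begin

lemma circular_order_circ_of: "circular_order_on Y (circ_of Y lt)"
proof -
  have "(c, b, a) \<notin> circ_of Y lt" if "(a, b, c) \<in> circ_of Y lt" for a b c
    using that irr trans unfolding circ_of_def by blast
  moreover have "(a, b, d) \<in> circ_of Y lt"
    if "(a, b, c) \<in> circ_of Y lt" "(a, c, d) \<in> circ_of Y lt" for a b c d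
    using that irr trans unfolding circ_of_def by blast
  moreover have "(a, b, c) \<in> circ_of Y lt \<or> (a, c, b) \<in> circ_of Y lt"
    if "a \<in> Y" "b \<in> Y" "c \<in> Y" "a \<noteq> b" "b \<noteq> c" "a \<noteq> c" for a b c
    using that total[of a b] total[of b c] total[of a c] unfolding circ_of_def by blast
  moreover have "(b, c, a) \<in> circ_of Y lt" if "(a, b, c) \<in> circ_of Y lt" for a b c
    using that unfolding circ_of_def by blast
  moreover have "circ_of Y lt \<subseteq> Y \<times> Y \<times> Y" unfolding circ_of_def by blast
  ultimately show ?thesis unfolding circular_order_on_def by blast
qed

sublocale circ: circ_order Y "circ_of Y lt"
  by unfold_locales (rule circular_order_circ_of)

section \<open>Compactness from least upper bounds\<close>

lemma open_basic_nbhd: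
  assumes "openin (interval_topology Y (circ_of Y lt)) U" "s \<in> U" "Y \<noteq> {s}"
  obtains c d where "c \<in> Y" "d \<in> Y" "s \<notin> closed_arc (circ_of Y lt) c d"
    "Y - closed_arc (circ_of Y lt) c d \<subseteq> U"
proof -
  have "s \<in> Y" using assms(1,2) circ.topspace_interval openin_subset by blast
  then obtain a where "a \<in> Y" "s \<noteq> a" using assms(3) by blast
  then show thesis using circ.open_basic_nbhd[OF assms(1,2)] that by blast
qed

text \<open>Consider a removed closed arc from \<open>c\<close> to \<open>d\<close> missing
  \<open>s\<close>. If \<open>d\<close> is below \<open>s\<close>, the arc does not meet the
  interval between \<open>d\<close> and \<open>s\<close>. If \<open>d\<close> is above
  \<open>s\<close>, then so is \<open>c\<close>, the arc is an ordinary interval above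
  \<open>s\<close>, and nothing below \<open>s\<close> is lost.\<close>

lemma lower_nbhd:
  assumes "openin (interval_topology Y (circ_of Y lt)) U" "s \<in> U"
  shows "(\<exists>l\<in>Y. lt l s \<and> (\<forall>z\<in>Y. lt l z \<and> lt z s \<longrightarrow> z \<in> U)) \<or> (\<forall>z\<in>Y. lt z s \<longrightarrow> z \<in> U)"
proof (cases "Y = {s}")
  case True
  then show ?thesis using irr by blast
next
  case False
  have s: "s \<in> Y" using assms(1,2) circ.topspace_interval openin_subset by blast
  obtain c d where cd: "c \<in> Y" "d \<in> Y" "s \<notin> closed_arc (circ_of Y lt) c d"
    "Y - closed_arc (circ_of Y lt) c d \<subseteq> U"
    using open_basic_nbhd[OF assms False] by blast
  have ne: "s \<noteq> c" "s \<noteq> d" and scd: "(c, s, d) \<notin> circ_of Y lt"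
    using cd(3) by (auto simp: closed_arc_def open_arc_def)
  have inU: "z \<in> U" if "z \<in> Y" "z \<noteq> c" "z \<noteq> d" "(c, z, d) \<notin> circ_of Y lt" for z
    using that cd(4) by (auto simp: closed_arc_def open_arc_def)
  show ?thesis
  proof (cases "lt d s")
    case True
    have dcs: "\<not> (lt d c \<and> lt c s)" using scd s cd(1,2) unfolding circ_of_def by blast
    have "z \<in> U" if z: "z \<in> Y" "lt d z" "lt z s" for z
    proof (rule inU)
      have nz: "\<not> lt z d" using z(2) trans irr by blast
      show "z \<noteq> c" "z \<noteq> d" using dcs z irr by blast+
      have "\<not> (lt d c \<and> lt c z)" using dcs z(3) trans by blast
      then show "(c, z, d) \<notin> circ_of Y lt" using nz unfolding circ_of_def by blast
    qed (rule z)
    then show ?thesis using True cd(2) by blast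
  next
    case False
    then have sd: "lt s d" using total s cd(2) ne by blast
    then have n: "\<not> lt c s" "\<not> lt d c" using scd s cd(1,2) unfolding circ_of_def by blast+
    then have sc: "lt s c" using total s cd(1) ne by blast
    have "z \<in> U" if z: "z \<in> Y" "lt z s" for z
    proof (rule inU)
      show "z \<noteq> c" "z \<noteq> d" using z sc sd trans irr by blast+
      have "\<not> lt c z" using z(2) sc trans irr by blast
      then show "(c, z, d) \<notin> circ_of Y lt" using n unfolding circ_of_def by blast
    qed (rule z)
    then show ?thesis by blast
  qed
qed

lemma upper_nbhd:
  assumes "openin (interval_topology Y (circ_of Y lt)) U" "s \<in> U"
  shows "(\<exists>r\<in>Y. lt s r \<and> (\<forall>z\<in>Y. lt s z \<and> lt z r \<longrightarrow> z \<in> U)) \<or> (\<forall>z\<in>Y. lt s z \<longrightarrow> z \<in> U)"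
proof (cases "Y = {s}")
  case True
  then show ?thesis using irr by blast
next
  case False
  have s: "s \<in> Y" using assms(1,2) circ.topspace_interval openin_subset by blast
  obtain c d where cd: "c \<in> Y" "d \<in> Y" "s \<notin> closed_arc (circ_of Y lt) c d"
    "Y - closed_arc (circ_of Y lt) c d \<subseteq> U"
    using open_basic_nbhd[OF assms False] by blast
  have ne: "s \<noteq> c" "s \<noteq> d" and scd: "(c, s, d) \<notin> circ_of Y lt"
    using cd(3) by (auto simp: closed_arc_def open_arc_def)
  have inU: "z \<in> U" if "z \<in> Y" "z \<noteq> c" "z \<noteq> d" "(c, z, d) \<notin> circ_of Y lt" for z
    using that cd(4) by (auto simp: closed_arc_def open_arc_def)
  show ?thesis
  proof (cases "lt s c")
    case True
    have sdc: "\<not> (lt s d \<and> lt d c)" using scd s cd(1,2) unfolding circ_of_def by blast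
    have "z \<in> U" if z: "z \<in> Y" "lt s z" "lt z c" for z
    proof (rule inU)
      have nz: "\<not> lt c z" using z(3) trans irr by blast
      show "z \<noteq> c" "z \<noteq> d" using sdc z irr by blast+
      have "\<not> (lt z d \<and> lt d c)" using sdc z(2) trans by blast
      then show "(c, z, d) \<notin> circ_of Y lt" using nz unfolding circ_of_def by blast
    qed (rule z)
    then show ?thesis using True cd(1) by blast
  next
    case False
    then have sd: "lt c s" using total s cd(1) ne by blast
    then have n: "\<not> lt s d" "\<not> lt d c" using scd s cd(1,2) unfolding circ_of_def by blast+
    then have ds: "lt d s" using total s cd(2) ne by blast
    have "z \<in> U" if z: "z \<in> Y" "lt s z" for z
    proof (rule inU)
      show "z \<noteq> c" "z \<noteq> d" using z ds sd trans irr by blast+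
      have "\<not> lt z d" using z(2) ds trans irr by blast
      then show "(c, z, d) \<notin> circ_of Y lt" using n unfolding circ_of_def by blast
    qed (rule z)
    then show ?thesis by blast
  qed
qed

text \<open>The supremum proof of the Heine-Borel theorem, applied to the points \<open>z\<close>
  for which \<open>down z\<close> is finitely covered. As the order is strict and total,
  \<open>\<not> lt s x\<close> says that \<open>x\<close> is at most \<open>s\<close>. Suprema are
  asked only for nonempty sets, so there may be no least element; the completion need not have
  one.\<close>

lemma compact_space_circ_of:
  assumes lub: "\<And>S. S \<subseteq> Y \<Longrightarrow> S \<noteq> {} \<Longrightarrow>
    \<exists>s\<in>Y. (\<forall>x\<in>S. \<not> lt s x) \<and> (\<forall>u\<in>Y. (\<forall>x\<in>S. \<not> lt u x) \<longrightarrow> \<not> lt u s)"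
  shows "compact_space (interval_topology Y (circ_of Y lt))"
  unfolding compact_space_alt circ.topspace_interval
proof (intro allI impI, elim conjE)
  fix \<U> assume op: "\<forall>U\<in>\<U>. openin (interval_topology Y (circ_of Y lt)) U" and cov: "Y \<subseteq> \<Union>\<U>"
  define fin where "fin A \<longleftrightarrow> (\<exists>\<F>. finite \<F> \<and> \<F> \<subseteq> \<U> \<and> A \<subseteq> \<Union>\<F>)" for A
  have fin_add: "fin B" if "fin A" "U \<in> \<U>" "B \<subseteq> A \<union> U" for A B U
  proof -
    obtain \<F> where "finite \<F>" "\<F> \<subseteq> \<U>" "A \<subseteq> \<Union>\<F>" using \<open>fin A\<close> unfolding fin_def by blast
    then have "finite (insert U \<F>)" "insert U \<F> \<subseteq> \<U>" "B \<subseteq> \<Union>(insert U \<F>)" using that by auto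
    then show ?thesis unfolding fin_def by blast
  qed
  have fin_empty: "fin {}" by (auto simp: fin_def)
  define down where "down z = {w \<in> Y. w = z \<or> lt w z}" for z
  have "fin Y"
  proof (cases "Y = {}")
    case True
    then show ?thesis using fin_empty by simp
  next
    case False
    then obtain t where t: "t \<in> Y" "\<And>x. x \<in> Y \<Longrightarrow> \<not> lt t x" using lub[of Y] by blast
    obtain U0 where U0: "U0 \<in> \<U>" "t \<in> U0" using cov t(1) by blast
    \<comment> \<open>The circle closes up at the greatest element \<open>t\<close>: if
      \<open>t\<close> is not the only point, its neighbourhood contains everything below some
      \<open>c\<close>. Adding a member through \<open>c\<close> makes the set of finitely covered
      points nonempty.\<close>
    have "\<exists>c\<in>Y. fin (down c)"
    proof (cases "Y = {t}")
      case True
      then have "down t \<subseteq> {} \<union> U0" using U0 by (auto simp: down_def)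
      then show ?thesis using fin_add[OF fin_empty U0(1)] t(1) by blast
    next
      case False
      obtain c d where cd: "c \<in> Y" "d \<in> Y" "t \<notin> closed_arc (circ_of Y lt) c d"
          "Y - closed_arc (circ_of Y lt) c d \<subseteq> U0"
        using open_basic_nbhd[OF _ U0(2) False] op U0(1) by blast
      have ne: "t \<noteq> c" "t \<noteq> d" and tcd: "(c, t, d) \<notin> circ_of Y lt"
        using cd(3) by (auto simp: closed_arc_def open_arc_def)
      have ct: "lt c t" "lt d t" using total[of _ t] t ne cd(1,2) by blast+
      have "w \<in> U0" if "w \<in> Y" "lt w c" for w
      proof -
        have "w \<noteq> c" "w \<noteq> d" "(c, w, d) \<notin> circ_of Y lt"
          using that ct tcd t(1) cd(1,2) irr trans unfolding circ_of_def by blast+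
        then have "w \<notin> closed_arc (circ_of Y lt) c d" by (auto simp: closed_arc_def open_arc_def)
        then show ?thesis using that(1) cd(4) by blast
      qed
      then have "down c - {c} \<subseteq> {} \<union> U0" by (auto simp: down_def)
      then have *: "fin (down c - {c})" by (rule fin_add[OF fin_empty U0(1)])
      obtain V where "V \<in> \<U>" "c \<in> V" using cov cd(1) by blast
      then have "fin (down c)" by (intro fin_add[OF *, of V]) blast+
      then show ?thesis using cd(1) by blast
    qed
    then obtain s where s: "s \<in> Y" "\<And>x. x \<in> Y \<Longrightarrow> fin (down x) \<Longrightarrow> \<not> lt s x"
        "\<And>u. u \<in> Y \<Longrightarrow> (\<forall>x\<in>Y. fin (down x) \<longrightarrow> \<not> lt u x) \<Longrightarrow> \<not> lt u s"
      using lub[of "{z \<in> Y. fin (down z)}"] by blast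
    obtain U where U: "U \<in> \<U>" "s \<in> U" using cov s(1) by blast
    then have opU: "openin (interval_topology Y (circ_of Y lt)) U" using op by blast
    have fs: "fin (down s)"
      using lower_nbhd[OF opU U(2)]
    proof
      assume "\<exists>l\<in>Y. lt l s \<and> (\<forall>z\<in>Y. lt l z \<and> lt z s \<longrightarrow> z \<in> U)"
      then obtain l where l: "l \<in> Y" "lt l s" "\<And>z. z \<in> Y \<Longrightarrow> lt l z \<Longrightarrow> lt z s \<Longrightarrow> z \<in> U" by blast
      then obtain g where g: "g \<in> Y" "fin (down g)" "lt l g" using s(3) by blast
      have "z \<in> down g \<union> U" if "z \<in> down s" for z
      proof (cases "z = s \<or> lt l z")
        case True
        then show ?thesis using that l(3) U(2) by (auto simp: down_def)
      next
        case False
        then have "z \<in> Y" "z = l \<or> lt z l" using that total l(1) by (auto simp: down_def)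
        then show ?thesis using g(3) trans by (auto simp: down_def)
      qed
      then have "down s \<subseteq> down g \<union> U" by blast
      then show ?thesis by (rule fin_add[OF g(2) U(1)])
    next
      assume "\<forall>z\<in>Y. lt z s \<longrightarrow> z \<in> U"
      then have "down s \<subseteq> {} \<union> U" using U(2) by (auto simp: down_def)
      then show ?thesis by (rule fin_add[OF fin_empty U(1)])
    qed
    show ?thesis
      using upper_nbhd[OF opU U(2)]
    proof
      assume "\<exists>r\<in>Y. lt s r \<and> (\<forall>z\<in>Y. lt s z \<and> lt z r \<longrightarrow> z \<in> U)"
      then obtain r where r: "r \<in> Y" "lt s r" "\<And>z. z \<in> Y \<Longrightarrow> lt s z \<Longrightarrow> lt z r \<Longrightarrow> z \<in> U" by blast
      \<comment> \<open>Such an \<open>r\<close> would be finitely covered although it lies above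
        the supremum \<open>s\<close>, so this case is contradictory.\<close>
      have "down r - {r} \<subseteq> down s \<union> U" using r(3) s(1) total unfolding down_def by blast
      then have *: "fin (down r - {r})" by (rule fin_add[OF fs U(1)])
      obtain V where "V \<in> \<U>" "r \<in> V" using cov r(1) by blast
      then have "fin (down r)" by (intro fin_add[OF *, of V]) blast+
      then show ?thesis using s(2) r(1,2) by blast
    next
      assume "\<forall>z\<in>Y. lt s z \<longrightarrow> z \<in> U"
      then have "Y \<subseteq> down s \<union> U" using s(1) total unfolding down_def by blast
      then show ?thesis by (rule fin_add[OF fs U(1)])
    qed
  qed
  then show "\<exists>\<F>. finite \<F> \<and> \<F> \<subseteq> \<U> \<and> Y \<subseteq> \<Union>\<F>" by (simp add: fin_def)
qed

end

section \<open>Cuts\<close>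

text \<open>First-order clauses for automation; totality stated for all pairs, equal ones included,
  absorbs reflexivity.\<close>

lemma linear_order_on_iff:
  "linear_order_on A r \<longleftrightarrow> r \<subseteq> A \<times> A \<and> (\<forall>a b c. (a, b) \<in> r \<longrightarrow> (b, c) \<in> r \<longrightarrow> (a, c) \<in> r) \<and>
    (\<forall>a b. (a, b) \<in> r \<longrightarrow> (b, a) \<in> r \<longrightarrow> a = b) \<and> (\<forall>a\<in>A. \<forall>b\<in>A. (a, b) \<in> r \<or> (b, a) \<in> r)"
proof -
  have "refl_on A r \<and> total_on A r \<longleftrightarrow> (\<forall>a\<in>A. \<forall>b\<in>A. (a, b) \<in> r \<or> (b, a) \<in> r)"
    unfolding refl_on_def total_on_def by metis
  then show ?thesis unfolding order_on_defs trans_def antisym_def by simp argo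
qed

lemma Field_linear_order: "linear_order_on A r \<Longrightarrow> Field r = A"
  unfolding linear_order_on_iff Field_def by blast

lemma linear_order_on_restrict:
  "linear_order_on A r \<Longrightarrow> B \<subseteq> A \<Longrightarrow> linear_order_on B (r \<inter> B \<times> B)"
  unfolding linear_order_on_iff by blast

lemma ordinal_sum3_iff:
  "(a, b) \<in> r \<oplus>\<^sub>o s \<oplus>\<^sub>o t \<longleftrightarrow> (a, b) \<in> r \<or> (a, b) \<in> s \<or> (a, b) \<in> t \<or>
     a \<in> Field r \<and> b \<in> Field s \<or> a \<in> Field r \<and> b \<in> Field t \<or> a \<in> Field s \<and> b \<in> Field t"
  by (auto simp: ordinal_sum_def Field_def)

text \<open>Relative to a base point \<open>x\<close> a cut \<open>L\<close> is encoded by the points which are not before \<open>x\<close>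
  in \<open>L\<close>. They form an initial segment of \<open>lower_point_cut X R x\<close>, and \<open>L\<close> moves this segment
  behind its complement.\<close>

definition upper_part :: "'a \<Rightarrow> 'a rel \<Rightarrow> 'a set" where
  "upper_part x L = {y. (x, y) \<in> L}"

definition cut_of_segment :: "'a set \<Rightarrow> 'a rel \<Rightarrow> 'a set \<Rightarrow> 'a rel" where
  "cut_of_segment X P E = {(a, b). a \<in> X \<and> b \<in> X \<and> ((a \<in> E \<longleftrightarrow> b \<in> E) \<and> (a, b) \<in> P \<or> a \<notin> E \<and> b \<in> E)}"

context circ_order
begin

abbreviation lpc :: "'a \<Rightarrow> 'a rel" where "lpc \<equiv> lower_point_cut X R"
abbreviation N :: "'a rel set" where "N \<equiv> novak_points X R"
abbreviation RN :: "('a rel \<times> 'a rel \<times> 'a rel) set" where "RN \<equiv> novak_order X R"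

lemma lpc_iff: "(a, b) \<in> lpc x \<longleftrightarrow> a \<in> X \<and> b \<in> X \<and> (a = b \<or> a = x \<or> (x, a, b) \<in> R)"
  by (simp add: lower_point_cut_def)

lemma linear_order_lpc:
  assumes "x \<in> X"
  shows "linear_order_on X (lpc x)"
proof -
  have "(a, c) \<in> lpc x" if "(a, b) \<in> lpc x" "(b, c) \<in> lpc x" for a b c
    using that tr[of x a b c] by (auto simp: lpc_iff)
  moreover have "a = b" if "(a, b) \<in> lpc x" "(b, a) \<in> lpc x" for a b
    using that asym'[of x a b] by (auto simp: lpc_iff)
  moreover have "(a, b) \<in> lpc x \<or> (b, a) \<in> lpc x" if "a \<in> X" "b \<in> X" for a b
    using that tot[of x a b] assms by (auto simp: lpc_iff)
  moreover have "lpc x \<subseteq> X \<times> X" by (auto simp: lpc_iff)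
  ultimately show ?thesis unfolding linear_order_on_iff by blast
qed

lemma circ_cut_lpc:
  assumes "x \<in> X"
  shows "circ_cut X R (lpc x)"
proof -
  have "(a, b, c) \<in> R" if "(a, b) \<in> lpc x" "a \<noteq> b" "(b, c) \<in> lpc x" "b \<noteq> c" for a b c
    using that tr'[of x a b c] by (auto simp: lpc_iff)
  then show ?thesis using linear_order_lpc[OF assms] unfolding circ_cut_def by blast
qed

lemma novak_point_cut: "L \<in> N \<Longrightarrow> circ_cut X R L"
  using circ_cut_lpc by (auto simp: novak_points_def circ_gap_def)

lemma lpc_in_novak_points: "x \<in> X \<Longrightarrow> lpc x \<in> N"
  by (simp add: novak_points_def)

end

locale based_circ_order = circ_order +
  fixes x0 assumes x0: "x0 \<in> X"
begin

abbreviation P :: "'a rel" where "P \<equiv> lpc x0"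
abbreviation D :: "'a rel \<Rightarrow> 'a set" where "D \<equiv> upper_part x0"

lemma P_refl: "a \<in> X \<Longrightarrow> (a, a) \<in> P"
  and P_trans: "(a, b) \<in> P \<Longrightarrow> (b, c) \<in> P \<Longrightarrow> (a, c) \<in> P"
  and P_antisym: "(a, b) \<in> P \<Longrightarrow> (b, a) \<in> P \<Longrightarrow> a = b"
  and P_total: "a \<in> X \<Longrightarrow> b \<in> X \<Longrightarrow> (a, b) \<in> P \<or> (b, a) \<in> P"
  using linear_order_lpc[OF x0] unfolding linear_order_on_iff by blast+

lemma P_base: "a \<in> X \<Longrightarrow> (x0, a) \<in> P"
  using x0 by (simp add: lpc_iff)

text \<open>The clause on \<open>x0\<close> discards the empty segment, which would encode the same
  cut as \<open>X\<close>, namely \<open>P\<close> itself.\<close>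

definition segment :: "'a set \<Rightarrow> bool" where
  "segment E \<longleftrightarrow> E \<subseteq> X \<and> x0 \<in> E \<and> (\<forall>a b. b \<in> E \<longrightarrow> (a, b) \<in> P \<longrightarrow> a \<in> E)"

lemma segment_chain:
  assumes "segment E" "segment E'"
  shows "E \<subseteq> E' \<or> E' \<subseteq> E"
  using assms P_total unfolding segment_def by blast

lemma segment_outside:
  assumes "segment E" "a \<in> E" "b \<in> X" "b \<notin> E"
  shows "(a, b) \<in> P" "(b, a) \<notin> P"
  using assms P_total unfolding segment_def by blast+

text \<open>For \<open>c\<close> before \<open>d\<close> in \<open>L\<close>, both behind
  \<open>x0\<close>, the cut property applied to \<open>x0\<close>, \<open>c\<close>,
  \<open>d\<close> gives their order from \<open>x0\<close>. If both precede \<open>x0\<close>,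
  apply it to \<open>c\<close>, \<open>d\<close>, \<open>x0\<close> and rotate. So \<open>L\<close>
  agrees with \<open>P\<close> inside \<open>D L\<close> and inside its complement, and the
  complement comes first.\<close>

lemma cut_eq:
  assumes L: "circ_cut X R L"
  shows "segment (D L)" "L = cut_of_segment X P (D L)"
proof -
  note lin = L[unfolded circ_cut_def, THEN conjunct1, unfolded linear_order_on_iff]
  have sub: "L \<subseteq> X \<times> X" using lin by (rule conjunct1)
  have tL: "(a, c) \<in> L" if "(a, b) \<in> L" "(b, c) \<in> L" for a b c
    using lin that by blast
  have aL: "a = b" if "(a, b) \<in> L" "(b, a) \<in> L" for a b
    using lin that by blast
  have totL: "(a, b) \<in> L \<or> (b, a) \<in> L" if "a \<in> X" "b \<in> X" for a b
    using lin that by blast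
  have cutL: "(a, b, c) \<in> R" if "(a, b) \<in> L" "a \<noteq> b" "(b, c) \<in> L" "b \<noteq> c" for a b c
    using L that unfolding circ_cut_def by blast
  have DI: "a \<in> D L \<longleftrightarrow> (x0, a) \<in> L" for a by (simp add: upper_part_def)
  have x0D: "x0 \<in> D L" using totL[OF x0 x0] DI by simp
  have before: "(a, x0) \<in> L" "a \<noteq> x0" if "a \<in> X" "a \<notin> D L" for a
    using totL[OF x0 that(1)] that(2) x0D DI by blast+
  have same: "(a, b) \<in> L \<longleftrightarrow> (a, b) \<in> P" if ab: "a \<in> X" "b \<in> X" "a \<in> D L \<longleftrightarrow> b \<in> D L" for a b
  proof -
    have imp: "(x0, c, d) \<in> R" if "(c, d) \<in> L" "c \<noteq> d" "c \<noteq> x0" "d \<noteq> x0" "c \<in> X" "d \<in> X"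
        "c \<in> D L \<longleftrightarrow> d \<in> D L" for c d
    proof (cases "c \<in> D L")
      case True
      then show ?thesis using cutL[of x0 c d] that DI by blast
    next
      case False
      then have "(d, x0) \<in> L" using before that by blast
      then have "(c, d, x0) \<in> R" using cutL[of c d x0] that by blast
      then show ?thesis by (rule rot2)
    qed
    consider "a = b" | "a \<noteq> b" "a = x0" | "a \<noteq> b" "b = x0" | "a \<noteq> b" "a \<noteq> x0" "b \<noteq> x0" by blast
    then show ?thesis
    proof cases
      case 1
      then show ?thesis using totL ab P_refl by blast
    next
      case 2
      then show ?thesis using ab x0D DI P_base by blast
    next
      case 3
      then have "(x0, a) \<in> L" using ab x0D DI by blast
      then have "(a, b) \<notin> L" using aL 3 by blast
      moreover have "(a, b) \<notin> P" using 3 by (simp add: lpc_iff)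
      ultimately show ?thesis by blast
    next
      case 4
      have "(a, b) \<in> P \<longleftrightarrow> (x0, a, b) \<in> R" using 4 ab by (simp add: lpc_iff)
      moreover have "(x0, a, b) \<in> R" if "(a, b) \<in> L" using imp[of a b] that 4 ab by blast
      moreover have "(x0, b, a) \<in> R" if "(b, a) \<in> L" using imp[of b a] that 4 ab by blast
      ultimately show ?thesis using totL[OF ab(1,2)] asym'[of x0 a b] by blast
    qed
  qed
  have cross: "(a, b) \<in> L" "(b, a) \<notin> L" if "a \<in> X" "a \<notin> D L" "b \<in> D L" for a b
    using before[OF that(1,2)] that(2,3) tL DI by blast+
  show "L = cut_of_segment X P (D L)"
  proof (intro set_eqI)
    fix p show "p \<in> L \<longleftrightarrow> p \<in> cut_of_segment X P (D L)"
    proof (cases p)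
      case (Pair a b)
      show ?thesis
      proof (cases "a \<in> X \<and> b \<in> X")
        case True
        then show ?thesis using same[of a b] cross[of a b] cross[of b a]
          unfolding Pair cut_of_segment_def by auto
      next
        case False
        then show ?thesis using sub unfolding Pair cut_of_segment_def by auto
      qed
    qed
  qed
  \<comment> \<open>If \<open>a\<close> preceded \<open>x0\<close> in \<open>L\<close>, then
    \<open>a\<close>, \<open>x0\<close>, \<open>b\<close> would be increasing in \<open>L\<close>,
    contradicting that \<open>a\<close> comes before \<open>b\<close> as seen from
    \<open>x0\<close>.\<close>
  have "a \<in> D L" if b: "b \<in> D L" and ab: "(a, b) \<in> P" for a b
  proof (rule ccontr)
    assume a: "a \<notin> D L"
    have aX: "a \<in> X" using ab by (simp add: lpc_iff)
    have ax: "(a, x0) \<in> L" "a \<noteq> x0" using before[OF aX a] by blast+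
    then have *: "a \<noteq> b" "(x0, a, b) \<in> R" using ab a b by (auto simp: lpc_iff)
    then have "b \<noteq> x0" by auto
    then have "(a, x0, b) \<in> R" using cutL[OF ax] b DI by blast
    then show False using *(2) asym'[of x0 a b] rot rot2 by blast
  qed
  moreover have "D L \<subseteq> X" using sub DI by blast
  ultimately show "segment (D L)" using x0D unfolding segment_def by blast
qed

lemma upper_part_inj:
  "circ_cut X R L \<Longrightarrow> circ_cut X R L' \<Longrightarrow> D L = D L' \<Longrightarrow> L = L'"
  using cut_eq(2) by metis

lemma cut_of_segment_iff:
  "(a, b) \<in> cut_of_segment X P E \<longleftrightarrow>
    a \<in> X \<and> b \<in> X \<and> ((a \<in> E \<longleftrightarrow> b \<in> E) \<and> (a, b) \<in> P \<or> a \<notin> E \<and> b \<in> E)"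
  by (simp add: cut_of_segment_def)

text \<open>Moving \<open>E\<close> behind its complement is a rotation: an increasing triple of the
  new order is a rotation of an increasing triple of \<open>P\<close>.\<close>

lemma circ_cut_cut_of_segment:
  assumes E: "segment E"
  shows "circ_cut X R (cut_of_segment X P E)" "D (cut_of_segment X P E) = E"
proof -
  note out = segment_outside[OF E]
  have EX: "E \<subseteq> X" "x0 \<in> E" using E by (auto simp: segment_def)
  have PR: "(a, b, c) \<in> R" if "(a, b) \<in> P" "a \<noteq> b" "(b, c) \<in> P" "b \<noteq> c" for a b c
    using circ_cut_lpc[OF x0] that unfolding circ_cut_def by blast
  show "D (cut_of_segment X P E) = E"
    using EX P_base by (auto simp: upper_part_def cut_of_segment_iff)
  have "linear_order_on X (cut_of_segment X P E)"
  proof -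
    have "(a, c) \<in> cut_of_segment X P E"
      if "(a, b) \<in> cut_of_segment X P E" "(b, c) \<in> cut_of_segment X P E" for a b c
      using that P_trans[of a b c] unfolding cut_of_segment_iff by blast
    moreover have "a = b"
      if "(a, b) \<in> cut_of_segment X P E" "(b, a) \<in> cut_of_segment X P E" for a b
      using that P_antisym[of a b] unfolding cut_of_segment_iff by blast
    moreover have "(a, b) \<in> cut_of_segment X P E \<or> (b, a) \<in> cut_of_segment X P E"
      if "a \<in> X" "b \<in> X" for a b
      using that P_total[of a b] unfolding cut_of_segment_iff by blast
    moreover have "cut_of_segment X P E \<subseteq> X \<times> X" by (auto simp: cut_of_segment_def)
    ultimately show ?thesis unfolding linear_order_on_iff by blast
  qed
  moreover have "(a, b, c) \<in> R" if abc: "(a, b) \<in> cut_of_segment X P E" "a \<noteq> b"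
    "(b, c) \<in> cut_of_segment X P E" "b \<noteq> c" for a b c
  proof -
    have X: "a \<in> X" "b \<in> X" "c \<in> X" using abc by (auto simp: cut_of_segment_iff)
    consider "(a, b) \<in> P" "(b, c) \<in> P" | "a \<notin> E" "b \<in> E" "c \<in> E" "(b, c) \<in> P"
      | "a \<notin> E" "b \<notin> E" "c \<in> E" "(a, b) \<in> P"
      using abc unfolding cut_of_segment_iff by blast
    then show ?thesis
    proof cases
      case 1
      then show ?thesis using PR abc by blast
    next
      case 2
      then have "(b, c, a) \<in> R" using PR[of b c a] out[of c a] X abc by blast
      then show ?thesis by (rule rot2)
    next
      case 3
      then have "(c, a, b) \<in> R" using PR[of c a b] out[of c a] X abc by blast
      then show ?thesis by (rule rot)
    qed
  qed
  ultimately show "circ_cut X R (cut_of_segment X P E)" unfolding circ_cut_def by blast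
qed

text \<open>The base point is exceptional: nothing is strictly before it, but the empty segment is
  replaced by \<open>X\<close>. Hence \<open>lpc x0\<close> becomes the greatest point of the
  completion rather than the least.\<close>

lemma upper_part_lpc:
  assumes "y \<in> X"
  shows "D (lpc y) = (if y = x0 then X else {z \<in> X. (z, y) \<in> P \<and> z \<noteq> y})"
proof -
  have "(x0, z) \<in> lpc y \<longleftrightarrow> z \<in> X \<and> (y = x0 \<or> (z, y) \<in> P \<and> z \<noteq> y)" for z
    using assms x0 rot[of y x0 z] rot2[of x0 z y] by (auto simp: lpc_iff)
  then show ?thesis by (auto simp: upper_part_def)
qed

end

section \<open>Novak's completion\<close>

context based_circ_order
begin

definition before :: "'a rel \<Rightarrow> 'a rel \<Rightarrow> bool" where
  "before L L' \<longleftrightarrow> D L \<subset> D L'"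

lemma novak_segment: "L \<in> N \<Longrightarrow> segment (D L)"
  using novak_point_cut cut_eq(1) by blast

lemma novak_eqI: "L \<in> N \<Longrightarrow> L' \<in> N \<Longrightarrow> D L = D L' \<Longrightarrow> L = L'"
  using novak_point_cut upper_part_inj by blast

lemma strict_linear_before: "strict_linear N before"
proof
  show "\<not> before L L" for L by (simp add: before_def)
  show "before L1 L3" if "before L1 L2" "before L2 L3" for L1 L2 L3
    using that by (auto simp: before_def)
  show "before L L' \<or> before L' L" if "L \<in> N" "L' \<in> N" "L \<noteq> L'" for L L'
    using segment_chain[OF novak_segment novak_segment] novak_eqI that
    unfolding before_def by blast
qed

section \<open>Novak's order as inclusion of segments\<close>

lemma novak_orderE:
  assumes "(L1, L2, L3) \<in> RN"
  obtains A B C rA rB rC where "L1 \<in> N" "L2 \<in> N" "L3 \<in> N" "L1 \<noteq> L2" "L2 \<noteq> L3" "L1 \<noteq> L3"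
    "A \<noteq> {}" "B \<noteq> {}" "C \<noteq> {}" "A \<inter> B = {}" "B \<inter> C = {}" "A \<inter> C = {}" "A \<union> B \<union> C = X"
    "linear_order_on A rA" "linear_order_on B rB" "linear_order_on C rC"
    "L1 = rA \<oplus>\<^sub>o rB \<oplus>\<^sub>o rC" "L2 = rB \<oplus>\<^sub>o rC \<oplus>\<^sub>o rA" "L3 = rC \<oplus>\<^sub>o rA \<oplus>\<^sub>o rB"
  using assms unfolding novak_order_def mem_Collect_eq prod.case
  by (elim conjE exE) (rule that; assumption)

lemma novak_order_ordinal_sums:
  assumes "L1 \<in> N" "L2 \<in> N" "L3 \<in> N" "L1 \<noteq> L2" "L2 \<noteq> L3" "L1 \<noteq> L3"
    and "A \<noteq> {}" "B \<noteq> {}" "C \<noteq> {}" "A \<inter> B = {}" "B \<inter> C = {}" "A \<inter> C = {}" "A \<union> B \<union> C = X"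
    and "linear_order_on A rA" "linear_order_on B rB" "linear_order_on C rC"
    and "L1 = rA \<oplus>\<^sub>o rB \<oplus>\<^sub>o rC" "L2 = rB \<oplus>\<^sub>o rC \<oplus>\<^sub>o rA" "L3 = rC \<oplus>\<^sub>o rA \<oplus>\<^sub>o rB"
  shows "(L1, L2, L3) \<in> RN"
  unfolding novak_order_def mem_Collect_eq prod.case
  by (intro conjI, (rule assms)+, rule exI[of _ A], rule exI[of _ B], rule exI[of _ C],
      rule exI[of _ rA], rule exI[of _ rB], rule exI[of _ rC], intro conjI) (rule assms)+

text \<open>Cutting the circle at the three points gives the arcs \<open>D L2 - D L1\<close>, \<open>D L3 - D L2\<close>
  and the remaining arc through the base point.\<close>

lemma novak_orderI:
  assumes N: "L1 \<in> N" "L2 \<in> N" "L3 \<in> N" and lt: "before L1 L2" "before L2 L3"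
  shows "(L1, L2, L3) \<in> RN"
proof -
  define D1 D2 D3 where "D1 = D L1" and "D2 = D L2" and "D3 = D L3"
  have seg: "segment D1" "segment D2" "segment D3"
    using novak_segment N by (simp_all add: D1_def D2_def D3_def)
  have sub: "D1 \<subset> D2" "D2 \<subset> D3" "D3 \<subseteq> X" "D1 \<noteq> {}"
    using lt seg by (auto simp: before_def D1_def D2_def D3_def segment_def)
  have L: "L1 = cut_of_segment X P D1" "L2 = cut_of_segment X P D2" "L3 = cut_of_segment X P D3"
    using cut_eq(2) novak_point_cut N by (simp_all add: D1_def D2_def D3_def)
  have lin: "linear_order_on X L1"
    using novak_point_cut[OF N(1)] by (simp add: circ_cut_def)
  \<comment> \<open>\<open>L1\<close> lists the complement of \<open>D1\<close> first, that is
    \<open>A\<close>, \<open>B\<close> and \<open>X - D3\<close>, and then \<open>D1\<close>. The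
    last two together form the arc \<open>C\<close> through the base point. The three orders only
    permute these blocks, so restrictions of \<open>L1\<close> serve for all of them.\<close>
  define A B C where "A = D2 - D1" and "B = D3 - D2" and "C = (X - D3) \<union> D1"
  have ABC: "A \<noteq> {}" "B \<noteq> {}" "C \<noteq> {}" "A \<inter> B = {}" "B \<inter> C = {}" "A \<inter> C = {}" "A \<union> B \<union> C = X"
    using sub by (auto simp: A_def B_def C_def)
  define rA rB rC where "rA = L1 \<inter> A \<times> A" and "rB = L1 \<inter> B \<times> B" and "rC = L1 \<inter> C \<times> C"
  have lins: "linear_order_on A rA" "linear_order_on B rB" "linear_order_on C rC"
    using linear_order_on_restrict[OF lin] ABC(7) by (auto simp: rA_def rB_def rC_def)
  have eq: "(a, b) \<in> L1 \<longleftrightarrow> (a, b) \<in> rA \<oplus>\<^sub>o rB \<oplus>\<^sub>o rC"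
      "(a, b) \<in> L2 \<longleftrightarrow> (a, b) \<in> rB \<oplus>\<^sub>o rC \<oplus>\<^sub>o rA"
      "(a, b) \<in> L3 \<longleftrightarrow> (a, b) \<in> rC \<oplus>\<^sub>o rA \<oplus>\<^sub>o rB" for a b
  proof -
    have o: "(a, b) \<in> P \<and> (b, a) \<notin> P"
      if "a \<in> D1 \<and> b \<notin> D1 \<or> a \<in> D2 \<and> b \<notin> D2 \<or> a \<in> D3 \<and> b \<notin> D3" "a \<in> X" "b \<in> X" for a b
      using that segment_outside[OF seg(1), of a b] segment_outside[OF seg(2), of a b]
        segment_outside[OF seg(3), of a b] by auto
    have ab: "(a, b) \<in> P" if "a \<in> D1 \<and> b \<notin> D1 \<or> a \<in> D2 \<and> b \<notin> D2 \<or> a \<in> D3 \<and> b \<notin> D3" "a \<in> X" "b \<in> X"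
      using o[of a b] that by blast
    have ba: "(a, b) \<notin> P" if "b \<in> D1 \<and> a \<notin> D1 \<or> b \<in> D2 \<and> a \<notin> D2 \<or> b \<in> D3 \<and> a \<notin> D3" "a \<in> X" "b \<in> X"
      using o[of b a] that by blast
    \<comment> \<open>The segments are nested, so a point has only five possible positions; for each
      pair of positions the three identities become propositional.\<close>
    have loc: "z \<notin> X \<and> z \<notin> D3 \<and> z \<notin> D2 \<and> z \<notin> D1 \<or> z \<in> X \<and> z \<notin> D3 \<and> z \<notin> D2 \<and> z \<notin> D1 \<or>
        z \<in> X \<and> z \<in> D3 \<and> z \<notin> D2 \<and> z \<notin> D1 \<or> z \<in> X \<and> z \<in> D3 \<and> z \<in> D2 \<and> z \<notin> D1 \<or>
        z \<in> X \<and> z \<in> D3 \<and> z \<in> D2 \<and> z \<in> D1" for z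
      using sub by blast
    note sum_iffs = ordinal_sum3_iff lins[THEN Field_linear_order]
    note iffs = rA_def rB_def rC_def A_def B_def C_def
      L cut_of_segment_iff Int_iff mem_Times_iff fst_conv snd_conv Diff_iff Un_iff
    show "(a, b) \<in> L1 \<longleftrightarrow> (a, b) \<in> rA \<oplus>\<^sub>o rB \<oplus>\<^sub>o rC"
    proof (cases "a \<in> X \<and> b \<in> X")
      case True
      then show ?thesis unfolding sum_iffs unfolding iffs using loc[of a] loc[of b]
        by (elim disjE conjE; simp only: ab ba simp_thms)
    next
      case False
      then show ?thesis unfolding sum_iffs unfolding iffs using loc[of a] loc[of b] by blast
    qed
    show "(a, b) \<in> L2 \<longleftrightarrow> (a, b) \<in> rB \<oplus>\<^sub>o rC \<oplus>\<^sub>o rA"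
    proof (cases "a \<in> X \<and> b \<in> X")
      case True
      then show ?thesis unfolding sum_iffs unfolding iffs using loc[of a] loc[of b]
        by (elim disjE conjE; simp only: ab ba simp_thms)
    next
      case False
      then show ?thesis unfolding sum_iffs unfolding iffs using loc[of a] loc[of b] by blast
    qed
    show "(a, b) \<in> L3 \<longleftrightarrow> (a, b) \<in> rC \<oplus>\<^sub>o rA \<oplus>\<^sub>o rB"
    proof (cases "a \<in> X \<and> b \<in> X")
      case True
      then show ?thesis unfolding sum_iffs unfolding iffs using loc[of a] loc[of b]
        by (elim disjE conjE; simp only: ab ba simp_thms)
    next
      case False
      then show ?thesis unfolding sum_iffs unfolding iffs using loc[of a] loc[of b] by blast
    qed
  qed
  have "L1 = rA \<oplus>\<^sub>o rB \<oplus>\<^sub>o rC" "L2 = rB \<oplus>\<^sub>o rC \<oplus>\<^sub>o rA" "L3 = rC \<oplus>\<^sub>o rA \<oplus>\<^sub>o rB"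
    using eq by (auto simp: set_eq_iff)
  moreover have "L1 \<noteq> L2" "L2 \<noteq> L3" "L1 \<noteq> L3" using lt by (auto simp: before_def)
  ultimately show ?thesis
    using N ABC lins by (intro novak_order_ordinal_sums)
qed

lemma novak_order_rot:
  assumes "(L1, L2, L3) \<in> RN"
  shows "(L2, L3, L1) \<in> RN"
  using assms
proof (rule novak_orderE)
  fix A B C rA rB rC
  assume *: "L1 \<in> N" "L2 \<in> N" "L3 \<in> N" "L1 \<noteq> L2" "L2 \<noteq> L3" "L1 \<noteq> L3"
    "A \<noteq> {}" "B \<noteq> {}" "C \<noteq> {}" "A \<inter> B = {}" "B \<inter> C = {}" "A \<inter> C = {}" "A \<union> B \<union> C = X"
    "linear_order_on A rA" "linear_order_on B rB" "linear_order_on C rC"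
    "L1 = rA \<oplus>\<^sub>o rB \<oplus>\<^sub>o rC" "L2 = rB \<oplus>\<^sub>o rC \<oplus>\<^sub>o rA" "L3 = rC \<oplus>\<^sub>o rA \<oplus>\<^sub>o rB"
  have "C \<inter> A = {}" "B \<inter> A = {}" "B \<union> C \<union> A = X" using *(10,12,13) by blast+
  then show ?thesis
    by (rule novak_order_ordinal_sums[OF *(2,3,1,5) *(6)[symmetric] *(4)[symmetric] *(8,9,7,11) _ _ _
        *(15,16,14,18,19,17)])
qed

text \<open>With \<open>x0\<close> in \<open>C\<close>, the points from \<open>x0\<close> on are
  first the tail \<open>E\<close> of \<open>C\<close>; moving \<open>A\<close> behind
  \<open>C\<close> adds \<open>A\<close>, and then moving \<open>B\<close> behind \<open>A\<close>
  adds \<open>B\<close>.\<close>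

lemma before_of_ordinal_sums:
  assumes lin: "linear_order_on A rA" "linear_order_on B rB" "linear_order_on C rC"
    and ne: "A \<noteq> {}" "B \<noteq> {}" "A \<inter> B = {}" "B \<inter> C = {}" "A \<inter> C = {}" "x0 \<in> C"
  shows "before (rA \<oplus>\<^sub>o rB \<oplus>\<^sub>o rC) (rB \<oplus>\<^sub>o rC \<oplus>\<^sub>o rA)"
    "before (rB \<oplus>\<^sub>o rC \<oplus>\<^sub>o rA) (rC \<oplus>\<^sub>o rA \<oplus>\<^sub>o rB)"
proof -
  have sub: "rA \<subseteq> A \<times> A" "rB \<subseteq> B \<times> B" "rC \<subseteq> C \<times> C" using lin by (simp_all add: linear_order_on_iff)
  have x: "x0 \<notin> A" "x0 \<notin> B" using ne by blast+
  define E where "E = {y. (x0, y) \<in> rC}"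
  have "D (rA \<oplus>\<^sub>o rB \<oplus>\<^sub>o rC) = E" "D (rB \<oplus>\<^sub>o rC \<oplus>\<^sub>o rA) = E \<union> A"
    "D (rC \<oplus>\<^sub>o rA \<oplus>\<^sub>o rB) = E \<union> A \<union> B"
    unfolding upper_part_def ordinal_sum3_iff lin[THEN Field_linear_order] E_def
    using sub x ne(6) by auto
  moreover have "E \<inter> A = {}" "(E \<union> A) \<inter> B = {}" using sub ne unfolding E_def by blast+
  then have "E \<subset> E \<union> A" "E \<union> A \<subset> E \<union> A \<union> B" using ne(1,2) by blast+
  ultimately show "before (rA \<oplus>\<^sub>o rB \<oplus>\<^sub>o rC) (rB \<oplus>\<^sub>o rC \<oplus>\<^sub>o rA)"
    "before (rB \<oplus>\<^sub>o rC \<oplus>\<^sub>o rA) (rC \<oplus>\<^sub>o rA \<oplus>\<^sub>o rB)"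
    by (simp_all add: before_def)
qed

lemma novak_orderD:
  assumes "(L1, L2, L3) \<in> RN"
  shows "before L1 L2 \<and> before L2 L3 \<or> before L2 L3 \<and> before L3 L1 \<or> before L3 L1 \<and> before L1 L2"
proof -
  obtain A B C rA rB rC where ne: "A \<noteq> {}" "B \<noteq> {}" "C \<noteq> {}"
    and disj: "A \<inter> B = {}" "B \<inter> C = {}" "A \<inter> C = {}" and un: "A \<union> B \<union> C = X"
    and lin: "linear_order_on A rA" "linear_order_on B rB" "linear_order_on C rC"
    and L: "L1 = rA \<oplus>\<^sub>o rB \<oplus>\<^sub>o rC" "L2 = rB \<oplus>\<^sub>o rC \<oplus>\<^sub>o rA" "L3 = rC \<oplus>\<^sub>o rA \<oplus>\<^sub>o rB"
    using assms by (rule novak_orderE)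
  have disj': "B \<inter> A = {}" "C \<inter> B = {}" "C \<inter> A = {}" using disj by blast+
  consider "x0 \<in> A" | "x0 \<in> B" | "x0 \<in> C" using x0 un by blast
  then show ?thesis
  proof cases
    case 1
    then show ?thesis
      using before_of_ordinal_sums[OF lin(2,3,1) ne(2,3) disj(2) disj'(3,1)] L by blast
  next
    case 2
    then show ?thesis
      using before_of_ordinal_sums[OF lin(3,1,2) ne(3,1) disj'(3) disj(1) disj'(2)] L by blast
  next
    case 3
    then show ?thesis
      using before_of_ordinal_sums[OF lin(1,2,3) ne(1,2) disj(1) disj(2,3)] L by blast
  qed
qed

text \<open>The right side depends on the base point, the left side does not. This permits choosing
  a new base point in each later argument.\<close>

lemma novak_order_eq: "RN = circ_of N before"
proof -
  have "(L1, L2, L3) \<in> RN \<longleftrightarrow> (L1, L2, L3) \<in> circ_of N before" for L1 L2 L3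
  proof
    assume "(L1, L2, L3) \<in> RN"
    moreover then have "L1 \<in> N \<and> L2 \<in> N \<and> L3 \<in> N" by (rule novak_orderE) simp
    ultimately show "(L1, L2, L3) \<in> circ_of N before"
      using novak_orderD unfolding circ_of_def by blast
  next
    assume "(L1, L2, L3) \<in> circ_of N before"
    then have N: "L1 \<in> N" "L2 \<in> N" "L3 \<in> N" and
      "before L1 L2 \<and> before L2 L3 \<or> before L2 L3 \<and> before L3 L1 \<or> before L3 L1 \<and> before L1 L2"
      unfolding circ_of_def by blast+
    then show "(L1, L2, L3) \<in> RN"
      using novak_orderI[of L1 L2 L3] novak_orderI[of L2 L3 L1] novak_orderI[of L3 L1 L2]
        novak_order_rot by blast
  qed
  then show ?thesis by auto
qed

lemma circular_order_novak: "circular_order_on N RN"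
  unfolding novak_order_eq by (rule strict_linear.circular_order_circ_of[OF strict_linear_before])

lemma novak_order_iff:
  assumes "L1 \<in> N" "L2 \<in> N" "L3 \<in> N"
  shows "(L1, L2, L3) \<in> RN \<longleftrightarrow>
    before L1 L2 \<and> before L2 L3 \<or> before L2 L3 \<and> before L3 L1 \<or> before L3 L1 \<and> before L1 L2"
  using assms by (simp add: novak_order_eq circ_of_def)

section \<open>Gaps and suprema of segments\<close>

text \<open>\<open>D L\<close> comes last in \<open>L\<close>, so its greatest element would be
  greatest in \<open>L\<close>.\<close>

lemma circ_gapD:
  assumes "circ_gap X R L" "z \<in> D L"
  shows "\<exists>y\<in>D L. z \<noteq> y \<and> (z, y) \<in> P"
proof (rule ccontr)
  assume neg: "\<not> (\<exists>y\<in>D L. z \<noteq> y \<and> (z, y) \<in> P)"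
  have cut: "circ_cut X R L" using assms(1) by (simp add: circ_gap_def)
  note seg = cut_eq(1)[OF cut]
  have zX: "z \<in> X" using seg assms(2) by (auto simp: segment_def)
  have "(x, z) \<in> L" if x: "x \<in> X" for x
  proof (cases "x \<in> D L")
    case True
    then have "(x, z) \<in> P" using neg P_total[OF x zX] P_refl[OF x] by metis
    then show ?thesis using cut_eq(2)[OF cut] cut_of_segment_iff[of x z "D L"] x zX True assms(2) by blast
  next
    case False
    then show ?thesis using cut_eq(2)[OF cut] cut_of_segment_iff[of x z "D L"] x zX False assms(2) by blast
  qed
  then show False using assms zX unfolding circ_gap_def by blast
qed

text \<open>The cut begins with \<open>X - E\<close> and ends with \<open>E\<close>, both nonempty.
  A least element would be least in \<open>X - E\<close>, a greatest one greatest in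
  \<open>E\<close>.\<close>

lemma circ_gap_cut_of_segment:
  assumes E: "segment E" "E \<noteq> X"
    and nomax: "\<And>z. z \<in> E \<Longrightarrow> \<exists>y\<in>E. (y, z) \<notin> P"
    and nomin: "\<And>z. z \<in> X - E \<Longrightarrow> \<exists>y\<in>X - E. (z, y) \<notin> P"
  shows "circ_gap X R (cut_of_segment X P E)"
proof -
  have EX: "E \<subseteq> X" "x0 \<in> E" using E by (auto simp: segment_def)
  have "\<exists>x\<in>X. (m, x) \<notin> cut_of_segment X P E" if "m \<in> X" for m
  proof (cases "m \<in> E")
    case True
    then show ?thesis using E(2) EX by (auto simp: cut_of_segment_iff)
  next
    case False
    then show ?thesis using nomin[of m] that by (auto simp: cut_of_segment_iff)
  qed
  moreover have "\<exists>x\<in>X. (x, m) \<notin> cut_of_segment X P E" if "m \<in> X" for m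
  proof (cases "m \<in> E")
    case True
    then show ?thesis using nomax[of m] EX by (auto simp: cut_of_segment_iff)
  next
    case False
    then show ?thesis using EX by (auto simp: cut_of_segment_iff)
  qed
  ultimately show ?thesis
    using circ_cut_cut_of_segment(1)[OF E(1)] unfolding circ_gap_def by blast
qed

text \<open>The union \<open>E\<close> of the segments is again a segment. It belongs to the base
  point if it is \<open>X\<close>, to a member of \<open>S\<close> if it is attained, and to
  \<open>lpc m\<close> if \<open>m\<close> is the least point outside. Otherwise it is a gap: a
  greatest point of \<open>E\<close> would lie in some \<open>D L\<close>, which would then be all
  of \<open>E\<close>.\<close>

lemma novak_lub:
  assumes S: "S \<subseteq> N" "S \<noteq> {}"
  shows "\<exists>s\<in>N. D s = (\<Union>L\<in>S. D L)"
proof -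
  define E where "E = (\<Union>L\<in>S. D L)"
  have seg: "segment (D L)" if "L \<in> S" for L using that S novak_segment by blast
  have segE: "segment E" unfolding segment_def
  proof (intro conjI allI impI)
    show "E \<subseteq> X" "x0 \<in> E" using seg S(2) unfolding E_def segment_def by blast+
    fix a b assume "b \<in> E" "(a, b) \<in> P"
    then show "a \<in> E" using seg unfolding E_def segment_def by blast
  qed
  note EX = segE[unfolded segment_def]
  consider "E = X" | L where "L \<in> S" "D L = E"
    | m where "m \<in> X - E" "\<forall>y\<in>X - E. (m, y) \<in> P"
    | "E \<noteq> X" "\<forall>L\<in>S. D L \<noteq> E" "\<forall>m\<in>X - E. \<exists>y\<in>X - E. (m, y) \<notin> P"
    by blast
  then have "\<exists>s\<in>N. D s = E"
  proof cases
    case 1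
    then show ?thesis using lpc_in_novak_points[OF x0] upper_part_lpc[OF x0] by auto
  next
    case 2
    then show ?thesis using S by blast
  next
    case 3
    have "m \<noteq> x0" using 3 EX by blast
    then have "D (lpc m) = {z \<in> X. (z, m) \<in> P \<and> z \<noteq> m}" using 3(1) upper_part_lpc by simp
    also have "\<dots> = E"
      using 3 segment_outside[OF segE] P_antisym EX by blast
    finally show ?thesis using lpc_in_novak_points 3(1) by blast
  next
    case 4
    have "\<exists>y\<in>E. (y, z) \<notin> P" if "z \<in> E" for z
    proof (rule ccontr)
      assume *: "\<not> (\<exists>y\<in>E. (y, z) \<notin> P)"
      obtain L where L: "L \<in> S" "z \<in> D L" using \<open>z \<in> E\<close> E_def by blast
      have "E \<subseteq> D L" using * L seg[OF L(1)] unfolding segment_def by blast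
      moreover have "D L \<subseteq> E" using L(1) E_def by blast
      ultimately show False using 4(2) L(1) by blast
    qed
    then have "circ_gap X R (cut_of_segment X P E)"
      using circ_gap_cut_of_segment[OF segE 4(1)] 4(3) by blast
    then show ?thesis
      using circ_cut_cut_of_segment(2)[OF segE] by (auto simp: novak_points_def)
  qed
  then show ?thesis by (simp add: E_def)
qed

lemma compact_space_novak: "compact_space (novak_topology X R)"
  unfolding novak_topology_def novak_order_eq
proof (rule strict_linear.compact_space_circ_of[OF strict_linear_before])
  fix S assume S: "S \<subseteq> N" "S \<noteq> {}"
  then obtain s where s: "s \<in> N" "D s = (\<Union>L\<in>S. D L)" using novak_lub by blast
  have "\<not> before s x" if "x \<in> S" for x
    using that s(2) unfolding before_def by blast
  moreover have "\<not> before u s" if "u \<in> N" "\<forall>x\<in>S. \<not> before u x" for u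
  proof -
    have "D x \<subseteq> D u" if "x \<in> S" for x
      using segment_chain[OF novak_segment novak_segment, of x u] that \<open>u \<in> N\<close> S(1)
        \<open>\<forall>x\<in>S. \<not> before u x\<close> unfolding before_def by blast
    then show ?thesis using s(2) unfolding before_def by blast
  qed
  ultimately show "\<exists>s\<in>N. (\<forall>x\<in>S. \<not> before s x) \<and> (\<forall>u\<in>N. (\<forall>x\<in>S. \<not> before u x) \<longrightarrow> \<not> before u s)"
    using s(1) by blast
qed

lemma before_lpc_iff:
  assumes "a \<in> X" "b \<in> X" "a \<noteq> x0" "b \<noteq> x0"
  shows "before (lpc a) (lpc b) \<longleftrightarrow> (x0, a, b) \<in> R"
proof -
  have "D (lpc a) = {z \<in> X. (z, a) \<in> P \<and> z \<noteq> a}" "D (lpc b) = {z \<in> X. (z, b) \<in> P \<and> z \<noteq> b}"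
    using assms upper_part_lpc by auto
  moreover have "(x0, a, b) \<in> R \<longleftrightarrow> (a, b) \<in> P \<and> a \<noteq> b" using assms by (auto simp: lpc_iff)
  moreover have "(a, b) \<in> P \<or> (b, a) \<in> P" using P_total assms by blast
  ultimately show ?thesis
    unfolding before_def using P_trans P_antisym assms(1,2) by (intro iffI; blast)
qed

lemma before_base:
  assumes "L \<in> N" "L \<noteq> lpc x0"
  shows "before L (lpc x0)"
  using assms novak_segment[OF assms(1)] novak_eqI[OF assms(1) lpc_in_novak_points[OF x0]]
    upper_part_lpc[OF x0] unfolding before_def segment_def by auto

lemma lpc_inj_base: "a \<in> X \<Longrightarrow> lpc a = lpc x0 \<Longrightarrow> a = x0"
  using upper_part_lpc[of a] upper_part_lpc[OF x0] by (auto split: if_splits)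

end

section \<open>The points of X inside the completion\<close>

context circ_order
begin

lemma based: "x \<in> X \<Longrightarrow> based_circ_order X R x"
  by unfold_locales

lemma lpc_inj: "a \<in> X \<Longrightarrow> b \<in> X \<Longrightarrow> lpc a = lpc b \<Longrightarrow> a = b"
  using based_circ_order.lpc_inj_base[OF based, of b a] by blast

text \<open>Cutting the circle at \<open>c\<close> reduces the circular order to a linear one.\<close>

lemma novak_order_lpc:
  assumes abc: "a \<in> X" "b \<in> X" "c \<in> X"
  shows "(lpc a, lpc b, lpc c) \<in> RN \<longleftrightarrow> (a, b, c) \<in> R"
proof (cases "a = c \<or> b = c")
  case True
  then show ?thesis by (auto simp: novak_order_def)
next
  case False
  interpret based_circ_order X R c using based abc(3) .
  have ne: "lpc a \<noteq> lpc c" "lpc b \<noteq> lpc c" using False lpc_inj abc by blast+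
  note N = abc[THEN lpc_in_novak_points]
  have top: "before (lpc a) (lpc c)" "before (lpc b) (lpc c)"
    using before_base N ne by blast+
  then have "(lpc a, lpc b, lpc c) \<in> RN \<longleftrightarrow> before (lpc a) (lpc b)"
    unfolding novak_order_iff[OF N] by (auto simp: before_def)
  also have "\<dots> \<longleftrightarrow> (c, a, b) \<in> R" using before_lpc_iff False abc by blast
  finally show ?thesis using rot rot2 by blast
qed

text \<open>A gap has neither a first nor a last point, so points of \<open>X\<close> approach it from both sides.\<close>

lemma novak_dense_left:
  assumes "a \<in> N" "p \<in> N" "a \<noteq> p"
  obtains x where "x \<in> X" "lpc x = a \<or> (a, lpc x, p) \<in> RN"
proof (cases "a \<in> lpc ` X \<or> X = {}")
  case True
  have "X \<noteq> {}"
  proof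
    assume X: "X = {}"
    \<comment> \<open>On the empty set the empty relation is the only cut, which contradicts
      \<open>a \<noteq> p\<close>.\<close>
    have "L = {}" if "circ_cut X R L" for L
      using that X unfolding circ_cut_def linear_order_on_iff by blast
    then show False using assms novak_point_cut by blast
  qed
  then show ?thesis using that True by blast
next
  case False
  then obtain x0 where x0: "x0 \<in> X" by blast
  interpret based_circ_order X R x0 using based x0 .
  have aX: "a \<noteq> lpc y" if "y \<in> X" for y using that False by blast
  have "before a p \<or> before p a" using strict_linear.total[OF strict_linear_before] assms by blast
  then show ?thesis
  proof
    assume ap: "before a p"
    then obtain y where y: "y \<in> D p" "y \<notin> D a" by (auto simp: before_def)
    have seg: "segment (D a)" "segment (D p)" using novak_segment assms by blast+
    have yX: "y \<in> X" and yx0: "y \<noteq> x0" using y seg by (auto simp: segment_def)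
    have Dy: "D (lpc y) = {z \<in> X. (z, y) \<in> P \<and> z \<noteq> y}" using upper_part_lpc yX yx0 by simp
    have "D a \<subseteq> D (lpc y)"
      unfolding Dy using segment_outside(1)[OF seg(1) _ yX y(2)] seg(1) y(2)
      unfolding segment_def by blast
    moreover have "D a \<noteq> D (lpc y)"
      using aX[OF yX] novak_eqI[OF assms(1) lpc_in_novak_points[OF yX]] by blast
    moreover have "D (lpc y) \<subset> D p"
      unfolding Dy using seg(2) y(1) unfolding segment_def by blast
    ultimately have "before a (lpc y)" "before (lpc y) p" unfolding before_def by blast+
    then show ?thesis using that[OF yX] novak_order_iff[OF assms(1) lpc_in_novak_points[OF yX] assms(2)]
      by blast
  next
    \<comment> \<open>Here the arc from \<open>a\<close> to \<open>p\<close> runs over the greatest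
      point of the completion, the one of the base point.\<close>
    assume "before p a"
    moreover have "before a (lpc x0)" using before_base aX x0 assms by blast
    ultimately show ?thesis
      using that[OF x0] novak_order_iff[OF assms(1) lpc_in_novak_points[OF x0] assms(2)] by blast
  qed
qed

text \<open>If \<open>b\<close> is a gap, \<open>D b\<close> has no greatest element, so it contains
  points arbitrarily late, and the point sought is taken from it.\<close>

lemma novak_dense_right:
  assumes "p \<in> N" "b \<in> N" "p \<noteq> b" "X \<noteq> {}"
  obtains x where "x \<in> X" "lpc x = b \<or> (p, lpc x, b) \<in> RN"
proof (cases "b \<in> lpc ` X")
  case True
  then show ?thesis using that by blast
next
  case False
  then have gap: "circ_gap X R b" using assms(2) by (auto simp: novak_points_def)
  obtain x0 where x0: "x0 \<in> X" using assms(4) by blast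
  interpret based_circ_order X R x0 using based x0 .
  have seg: "segment (D b)" "segment (D p)" using novak_segment assms by blast+
  have lpc_before: "before (lpc y) b" if "y \<in> D b" "y \<noteq> x0" for y
  proof -
    have "y \<in> X" using that seg by (auto simp: segment_def)
    then have "D (lpc y) = {z \<in> X. (z, y) \<in> P \<and> z \<noteq> y}" using upper_part_lpc that by simp
    then show ?thesis using seg(1) that unfolding before_def segment_def by blast
  qed
  have "before p b \<or> before b p" using strict_linear.total[OF strict_linear_before] assms by blast
  then show ?thesis
  proof
    assume "before p b"
    then obtain y where y: "y \<in> D b" "y \<notin> D p" by (auto simp: before_def)
    \<comment> \<open>\<open>lpc y\<close> may be \<open>p\<close> itself. A later \<open>y'\<close>
      puts \<open>y\<close> into \<open>D (lpc y')\<close>, which makes the inclusion of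
      \<open>D p\<close> strict.\<close>
    then obtain y' where y': "y' \<in> D b" "y \<noteq> y'" "(y, y') \<in> P" using circ_gapD[OF gap] by blast
    have X: "y \<in> X" "y' \<in> X" "x0 \<in> D p" using y y' seg by (auto simp: segment_def)
    have "y' \<noteq> x0" using y'(2,3) by (auto simp: lpc_iff)
    then have Dy: "D (lpc y') = {z \<in> X. (z, y') \<in> P \<and> z \<noteq> y'}" using upper_part_lpc X by simp
    have yP: "(z, y) \<in> P" if "z \<in> D p" for z using segment_outside(1)[OF seg(2) that X(1) y(2)] .
    have "D p \<subseteq> D (lpc y')"
      using yP y' P_trans P_antisym seg(2) y(2) unfolding Dy segment_def by blast
    moreover have "y \<in> D (lpc y')" using y' X by (simp add: Dy)
    ultimately have "before p (lpc y')" using y(2) unfolding before_def by blast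
    then show ?thesis using that[OF X(2)] lpc_before[OF y'(1) \<open>y' \<noteq> x0\<close>]
        novak_order_iff[OF assms(1) lpc_in_novak_points[OF X(2)] assms(2)] by blast
  next
    assume "before b p"
    have "x0 \<in> D b" using seg by (simp add: segment_def)
    then obtain y where y: "y \<in> D b" "y \<noteq> x0" using circ_gapD[OF gap] by blast
    then have "y \<in> X" using seg by (auto simp: segment_def)
    then show ?thesis using that[of y] lpc_before[OF y] \<open>before b p\<close>
        novak_order_iff[OF assms(1) lpc_in_novak_points[of y] assms(2)] by blast
  qed
qed

section \<open>The star uniformity\<close>

text \<open>Meant for the completion: the ends of an arc around \<open>p\<close> may be gaps, and
  density replaces them by points of \<open>X\<close> closer to \<open>p\<close>.\<close>

lemma open_arc_subset_of_closer_ends: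
  assumes cpd: "(c, p, d) \<in> R" and x: "x = c \<or> (c, x, p) \<in> R" and y: "y = d \<or> (p, y, d) \<in> R"
  shows "(x, p, y) \<in> R" "open_arc R x y \<subseteq> open_arc R c d"
proof -
  have xpd: "(x, p, d) \<in> R" using x tr'[OF _ cpd] cpd by blast
  have pdx: "(p, d, x) \<in> R" using xpd by (rule rot)
  have "(p, y, x) \<in> R" using y tr[OF _ pdx] pdx by blast
  then show "(x, p, y) \<in> R" by (rule rot2)
  have "y = d \<or> (y, d, x) \<in> R" using y tr'[OF _ pdx] by blast
  then have xyd: "y = d \<or> (x, y, d) \<in> R" using rot2 by blast
  have "x = c \<or> (c, x, d) \<in> R" using x tr[OF _ cpd] by blast
  then have xdc: "x = c \<or> (x, d, c) \<in> R" using rot by blast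
  have "(c, z, d) \<in> R" if "(x, z, y) \<in> R" for z
  proof -
    have "(x, z, d) \<in> R" using xyd that tr by blast
    then have "x = c \<or> (z, d, c) \<in> R" using xdc tr' by blast
    then show ?thesis using \<open>(x, z, d) \<in> R\<close> rot2 by blast
  qed
  then show "open_arc R x y \<subseteq> open_arc R c d" by auto
qed

text \<open>Computed directly in \<open>X\<close>: members of star covers are open arcs, and a
  three-point cycle with middle point \<open>x\<close> isolates any arc around \<open>x\<close> as a
  star.\<close>

lemma uniform_topology_star_uniformity:
  assumes cu: "covering_uniformity X (star_uniformity X R)"
    and base: "uniformity_base (star_uniformity X R) (star_covers X R)"
    and three: "\<And>a b. a \<in> X \<Longrightarrow> b \<in> X \<Longrightarrow> \<exists>c\<in>X. c \<noteq> a \<and> c \<noteq> b"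
  shows "uniform_topology X (star_uniformity X R) = interval_topology X R"
proof -
  let ?\<mu> = "star_uniformity X R"
  have star_nbhd: "\<exists>\<C>\<in>?\<mu>. cover_star {x} \<C> \<subseteq> open_arc R b a" if bxa: "(b, x, a) \<in> R" for a b x
  proof -
    \<comment> \<open>The three arcs of this cycle are \<open>(b, a)\<close>, \<open>(x, b)\<close>
      and \<open>(a, x)\<close>; only the first contains \<open>x\<close>.\<close>
    let ?F = "[b, x, a]"
    have "cycle_in X R ?F"
      unfolding cycle_in_def using bxa rot[OF bxa] rot2[OF bxa] neqs[OF bxa] in_X[OF bxa]
      by (auto simp: less_Suc_eq)
    then have "star_cover R ?F \<in> star_covers X R" by (force simp: star_covers_def)
    then have "star_cover R ?F \<in> ?\<mu>" using base by (auto simp: uniformity_base_def)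
    moreover have "cover_star {x} (star_cover R ?F) \<subseteq> open_arc R b a"
      by (auto simp: cover_star_def star_cover_def less_Suc_eq)
    ultimately show ?thesis by blast
  qed
  have "openin (uniform_topology X ?\<mu>) U \<longleftrightarrow> openin (interval_topology X R) U" for U
  proof
    assume "openin (uniform_topology X ?\<mu>) U"
    then have U: "U \<subseteq> X" "\<And>x. x \<in> U \<Longrightarrow> \<exists>\<C>\<in>?\<mu>. cover_star {x} \<C> \<subseteq> U"
      using openin_uniform_topology[OF cu] by blast+
    have "\<exists>V. openin (interval_topology X R) V \<and> x \<in> V \<and> V \<subseteq> U" if x: "x \<in> U" for x
    proof -
      obtain \<C> where C: "\<C> \<in> ?\<mu>" "cover_star {x} \<C> \<subseteq> U" using U(2)[OF x] by blast
      then obtain F where F: "cycle_in X R F" "3 \<le> length F" "cover_refines (star_cover R F) \<C>"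
        using base unfolding uniformity_base_def star_covers_def by blast
      obtain A where A: "A \<in> star_cover R F" "x \<in> A" using Union_star_cover[OF F(1,2)] x U(1) by blast
      then obtain i where i: "i < length F" "A = open_arc R (F ! i) (F ! ((i + 2) mod length F))"
        by (auto simp: star_cover_def)
      have "(i + 2) mod length F < length F" using i(1) by (intro mod_less_divisor) linarith
      then have "F ! i \<in> X" "F ! ((i + 2) mod length F) \<in> X"
        using i(1) F(1) nth_mem unfolding cycle_in_def by blast+
      then have "openin (interval_topology X R) A" unfolding i(2) by (rule openin_open_arc)
      moreover obtain B where B: "B \<in> \<C>" "A \<subseteq> B" using F(3) A(1) by (auto simp: cover_refines_def)
      moreover have "B \<subseteq> cover_star {x} \<C>" using A(2) B by (auto simp: cover_star_def)
      ultimately show ?thesis using A(2) C(2) by blast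
    qed
    then show "openin (interval_topology X R) U" by (subst openin_subopen) blast
  next
    assume U: "openin (interval_topology X R) U"
    have UX: "U \<subseteq> X" using openin_subset[OF U] topspace_interval by simp
    have "\<exists>\<C>\<in>?\<mu>. cover_star {x} \<C> \<subseteq> U" if x: "x \<in> U" for x
    proof -
      obtain a where a: "a \<in> X" "a \<noteq> x" using three x UX by blast
      then obtain b where b: "b \<in> X" "b \<noteq> x" "b \<noteq> a" using three[of x a] x UX by blast
      obtain c d where cd: "(c, x, d) \<in> R" "open_arc R c d \<subseteq> U"
        by (rule open_arc_nbhd[OF U x a(1) b(1) a(2)[symmetric] b(2)[symmetric] b(3)[symmetric]])
      then show ?thesis using star_nbhd by blast
    qed
    then show "openin (uniform_topology X ?\<mu>) U" using openin_uniform_topology[OF cu] UX by blast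
  qed
  then show ?thesis by (simp add: topology_eq)
qed

lemma circular_order_novak_nonempty: "X \<noteq> {} \<Longrightarrow> circular_order_on N RN"
  using based_circ_order.circular_order_novak[OF based] by blast

lemma novak_three:
  assumes X: "X \<noteq> {}" and three: "\<And>a b. a \<in> X \<Longrightarrow> b \<in> X \<Longrightarrow> \<exists>c\<in>X. c \<noteq> a \<and> c \<noteq> b"
  shows "\<exists>M\<in>N. M \<noteq> L \<and> M \<noteq> L'"
proof -
  obtain a where a: "a \<in> X" using X by blast
  obtain b where b: "b \<in> X" "b \<noteq> a" using three a by blast
  obtain c where c: "c \<in> X" "c \<noteq> a" "c \<noteq> b" using three a b by blast
  have "lpc a \<noteq> lpc b" "lpc b \<noteq> lpc c" "lpc a \<noteq> lpc c" using lpc_inj a b c by blast+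
  then show ?thesis using lpc_in_novak_points a b(1) c(1) by metis
qed

lemma the_novak_uniformity:
  assumes X: "X \<noteq> {}" and three: "\<And>a b. a \<in> X \<Longrightarrow> b \<in> X \<Longrightarrow> \<exists>c\<in>X. c \<noteq> a \<and> c \<noteq> b"
  shows "compatible_uniformity (novak_topology X R) (open_cover_uniformity (novak_topology X R))"
    and "(THE \<mu>. compatible_uniformity (novak_topology X R) \<mu>) =
      open_cover_uniformity (novak_topology X R)"
proof -
  interpret nov: circ_order N RN by unfold_locales (rule circular_order_novak_nonempty[OF X])
  have "topspace (novak_topology X R) \<noteq> {}"
    using X lpc_in_novak_points by (auto simp: novak_topology_def nov.topspace_interval)
  moreover have "compact_space (novak_topology X R)"
    using based_circ_order.compact_space_novak[OF based] X by blast
  moreover have "Hausdorff_space (novak_topology X R)"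
    unfolding novak_topology_def using nov.Hausdorff_interval novak_three[OF X three] by blast
  ultimately show
    "compatible_uniformity (novak_topology X R) (open_cover_uniformity (novak_topology X R))"
    "(THE \<mu>. compatible_uniformity (novak_topology X R) \<mu>) =
      open_cover_uniformity (novak_topology X R)"
    using compatible_open_cover_uniformity the_compatible_uniformity by blast+
qed

lemma star_uniformity_eq_novak_uniformity:
  assumes X: "X \<noteq> {}" and three: "\<And>a b. a \<in> X \<Longrightarrow> b \<in> X \<Longrightarrow> \<exists>c\<in>X. c \<noteq> a \<and> c \<noteq> b"
  shows "star_uniformity X R = novak_uniformity X R"
    and "uniformity_base (star_uniformity X R) (star_covers X R)"
proof -
  interpret nov: circ_order N RN by unfold_locales (rule circular_order_novak_nonempty[OF X])
  let ?T = "novak_topology X R"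
  have top: "topspace ?T = N" by (simp add: novak_topology_def nov.topspace_interval)
  note N = lpc_in_novak_points
  have compact: "compact_space ?T"
    using based_circ_order.compact_space_novak[OF based] X by blast
  obtain a0 where a0: "a0 \<in> X" using X by blast
  obtain b0 where b0: "b0 \<in> X" "b0 \<noteq> a0" using three a0 by blast
  obtain c0 where c0: "c0 \<in> X" "c0 \<noteq> a0" "c0 \<noteq> b0" using three a0 b0 by blast
  have card3: "3 \<le> card Q" if "finite Q" "{a0, b0, c0} \<subseteq> Q" for Q
  proof -
    have "card {a0, b0, c0} = 3" using b0 c0 by auto
    then show ?thesis using card_mono[OF that] by simp
  qed
  obtain F0 where F0: "cycle_in X R F0" "set F0 = {a0, b0, c0}"
    using finite_cycle[of "{a0, b0, c0}"] a0 b0 c0 by blast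
  have F03: "3 \<le> length F0" using cycle_in_length[OF F0(1)] F0(2) card3[of "{a0, b0, c0}"] by simp
  have star_char: "\<C> \<in> star_uniformity X R \<longleftrightarrow>
      cover_of X \<C> \<and> (\<exists>F. cycle_in X R F \<and> 3 \<le> length F \<and> cover_refines (star_cover R F) \<C>)" for \<C>
  proof -
    \<comment> \<open>The extra generator \<open>{X}\<close> is absorbed, since the star cover of
      the triangle \<open>F0\<close> refines it.\<close>
    have "cover_refines (star_cover R F0) \<C>" if "cover_refines {X} \<C>"
    proof -
      have "cover_refines (star_cover R F0) {X}"
        using Union_star_cover[OF F0(1) F03] by (auto simp: cover_refines_def)
      then show ?thesis using that cover_refines_trans by blast
    qed
    then show ?thesis using F0(1) F03
      unfolding star_uniformity_def generated_uniformity_def star_covers_def by blast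
  qed
  show "uniformity_base (star_uniformity X R) (star_covers X R)"
  proof -
    have "star_cover R F \<in> star_uniformity X R" if "cycle_in X R F" "3 \<le> length F" for F
      unfolding star_char using that Union_star_cover[OF that]
      by (auto simp: cover_of_def cover_refines_def)
    then have "star_covers X R \<subseteq> star_uniformity X R" by (auto simp: star_covers_def)
    moreover have "\<exists>\<D>\<in>star_covers X R. cover_refines \<D> \<C>" if "\<C> \<in> star_uniformity X R" for \<C>
      using that unfolding star_char star_covers_def by blast
    ultimately show ?thesis unfolding uniformity_base_def by blast
  qed
  have novak_char: "\<C> \<in> novak_uniformity X R \<longleftrightarrow> cover_of X \<C> \<and>
      (\<exists>\<V>\<in>open_cover_uniformity ?T. cover_refines ((\<lambda>V. lpc -` V \<inter> X) ` \<V>) \<C>)" for \<C>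
    by (simp add: novak_uniformity_def the_novak_uniformity(2)[OF X three] induced_uniformity_def)
  show "star_uniformity X R = novak_uniformity X R"
  proof (intro equalityI subsetI)
    fix \<C> assume "\<C> \<in> star_uniformity X R"
    then obtain F where C: "cover_of X \<C>" and F: "cycle_in X R F" "3 \<le> length F"
        "cover_refines (star_cover R F) \<C>"
      unfolding star_char by blast
    let ?G = "map lpc F"
    have FX: "F ! i \<in> X" if "i < length F" for i using F(1) that nth_mem unfolding cycle_in_def by blast
    have cyc: "cycle_in N RN ?G"
      unfolding cycle_in_def
    proof (intro conjI allI impI)
      show "set ?G \<subseteq> N" using F(1) N by (auto simp: cycle_in_def)
      show "distinct ?G"
        using F(1) lpc_inj by (auto simp: cycle_in_def distinct_map inj_on_def)
      fix i j k assume *: "i < length ?G" "j < length ?G" "k < length ?G"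
        "i < j \<and> j < k \<or> j < k \<and> k < i \<or> k < i \<and> i < j"
      then have "(F ! i, F ! j, F ! k) \<in> R" using F(1) unfolding cycle_in_def length_map by blast
      then show "(?G ! i, ?G ! j, ?G ! k) \<in> RN" using * FX novak_order_lpc by simp
    qed
    have idx: "(i + 2) mod length F < length F" if "i < length F" for i
      using that by (intro mod_less_divisor) linarith
    have "star_cover RN ?G \<in> open_cover_uniformity ?T"
    proof (rule open_cover_in_open_cover_uniformity)
      show "\<Union>(star_cover RN ?G) = topspace ?T" using nov.Union_star_cover[OF cyc] F(2) top by simp
      show "\<forall>V\<in>star_cover RN ?G. openin ?T V"
        using FX idx N by (auto simp: star_cover_def novak_topology_def intro!: nov.openin_open_arc)
    qed
    moreover have "cover_refines ((\<lambda>V. lpc -` V \<inter> X) ` star_cover RN ?G) (star_cover R F)"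
      unfolding cover_refines_def
    proof
      fix A assume "A \<in> (\<lambda>V. lpc -` V \<inter> X) ` star_cover RN ?G"
      then obtain i where i: "i < length F"
          and A: "A = lpc -` open_arc RN (?G ! i) (?G ! ((i + 2) mod length ?G)) \<inter> X"
        unfolding star_cover_def length_map by blast
      have "A \<subseteq> open_arc R (F ! i) (F ! ((i + 2) mod length F))"
        unfolding A using i idx[OF i] FX novak_order_lpc by auto
      moreover have "open_arc R (F ! i) (F ! ((i + 2) mod length F)) \<in> star_cover R F"
        using i unfolding star_cover_def by blast
      ultimately show "\<exists>B\<in>star_cover R F. A \<subseteq> B" by (rule bexI)
    qed
    ultimately show "\<C> \<in> novak_uniformity X R"
      unfolding novak_char using C F(3) cover_refines_trans by blast
  next
    fix \<C> assume "\<C> \<in> novak_uniformity X R"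
    then obtain \<V>' where C: "cover_of X \<C>" and V': "\<V>' \<in> open_cover_uniformity ?T"
        "cover_refines ((\<lambda>V. lpc -` V \<inter> X) ` \<V>') \<C>"
      unfolding novak_char by blast
    obtain \<V> where V: "\<forall>V\<in>\<V>. openin ?T V" "\<Union>\<V> = N" "cover_refines \<V> \<V>'"
      using V'(1) top unfolding open_cover_uniformity_def by blast
    have "\<exists>x y. x \<in> X \<and> y \<in> X \<and> (lpc x, p, lpc y) \<in> RN \<and> (\<exists>V\<in>\<V>. open_arc RN (lpc x) (lpc y) \<subseteq> V)"
      if p: "p \<in> N" for p
    proof -
      obtain W where W: "W \<in> \<V>" "p \<in> W" using V(2) p by blast
      \<comment> \<open>\<open>a\<close> and \<open>b\<close> are the two further points that
        \<open>open_arc_nbhd\<close> asks for.\<close>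
      obtain a where a: "a \<in> N" "a \<noteq> p" using novak_three[OF X three] by blast
      obtain b where b: "b \<in> N" "b \<noteq> p" "b \<noteq> a" using novak_three[OF X three] by blast
      have "openin (interval_topology N RN) W" using V(1) W(1) by (simp add: novak_topology_def)
      then obtain c d where cd: "(c, p, d) \<in> RN" "open_arc RN c d \<subseteq> W"
        using nov.open_arc_nbhd[OF _ W(2) a(1) b(1) a(2)[symmetric] b(2)[symmetric] b(3)[symmetric]]
        by blast
      have cdN: "c \<in> N" "d \<in> N" "c \<noteq> p" "p \<noteq> d" using nov.in_X[OF cd(1)] nov.neqs[OF cd(1)] by blast+
      \<comment> \<open>\<open>c\<close> and \<open>d\<close> may be gaps; both ends are moved
        towards \<open>p\<close> until they come from \<open>X\<close>.\<close>
      obtain x where x: "x \<in> X" "lpc x = c \<or> (c, lpc x, p) \<in> RN"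
        using novak_dense_left[OF cdN(1) p cdN(3)] by blast
      obtain y where y: "y \<in> X" "lpc y = d \<or> (p, lpc y, d) \<in> RN"
        using novak_dense_right[OF p cdN(2,4) X] by blast
      show ?thesis
        using nov.open_arc_subset_of_closer_ends[OF cd(1) x(2) y(2)] x(1) y(1) cd(2) W(1) by blast
    qed
    then obtain l r where lr: "\<And>p. p \<in> N \<Longrightarrow> l p \<in> X \<and> r p \<in> X \<and> (lpc (l p), p, lpc (r p)) \<in> RN \<and>
        (\<exists>V\<in>\<V>. open_arc RN (lpc (l p)) (lpc (r p)) \<subseteq> V)"
      by metis
    define G where "G p = open_arc RN (lpc (l p)) (lpc (r p))" for p
    have "openin ?T (G p) \<and> p \<in> G p" if "p \<in> topspace ?T" for p
      using that lr N nov.openin_open_arc unfolding top G_def by (simp add: novak_topology_def)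
    then obtain Q where Q: "finite Q" "Q \<subseteq> N" "N \<subseteq> (\<Union>p\<in>Q. G p)"
      using compact_space_pointwise_cover[OF compact, of G] top by metis
    \<comment> \<open>The ends of the finitely many arcs, padded by \<open>a0\<close>,
      \<open>b0\<close>, \<open>c0\<close> so that the cycle has at least three points.\<close>
    define S where "S = {a0, b0, c0} \<union> l ` Q \<union> r ` Q"
    have S: "finite S" "S \<subseteq> X" "S \<noteq> {}" using Q lr a0 b0 c0 unfolding S_def by auto
    obtain F where F: "cycle_in X R F" "set F = S" using finite_cycle[OF S] by blast
    have F3: "3 \<le> length F"
      using cycle_in_length[OF F(1)] F(2) card3[OF S(1)] by (simp add: S_def)
    have "\<exists>B\<in>\<C>. open_arc R (F ! i) (F ! ((i + 2) mod length F)) \<subseteq> B" if i: "i < length F" for i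
    proof -
      \<comment> \<open>The middle point decides which \<open>G p\<close> to use: once
        \<open>lpc m\<close> lies in \<open>G p\<close>, the whole arc of the star cover
        does.\<close>
      define m where "m = F ! ((i + 1) mod length F)"
      have "(i + 1) mod length F < length F" using i by (intro mod_less_divisor) linarith
      then have mX: "m \<in> X" using F S(2) nth_mem unfolding m_def by blast
      then obtain p where p: "p \<in> Q" "lpc m \<in> G p" using Q(3) N by blast
      then have pN: "p \<in> N" using Q(2) by blast
      have lrX: "l p \<in> X" "r p \<in> X" using lr[OF pN] by blast+
      have "(l p, m, r p) \<in> R" using p(2) novak_order_lpc[OF lrX(1) mX lrX(2)] by (simp add: G_def)
      moreover have "l p \<in> set F" "r p \<in> set F" using p(1) F(2) S_def by auto
      ultimately have "open_arc R (F ! i) (F ! ((i + 2) mod length F)) \<subseteq> open_arc R (l p) (r p)"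
        using star_cover_arc_subset[OF F(1) F3 i] m_def by blast
      also have "\<dots> \<subseteq> lpc -` G p \<inter> X"
        using novak_order_lpc[OF lrX(1) _ lrX(2)] in_X by (auto simp: G_def)
      finally have arc: "open_arc R (F ! i) (F ! ((i + 2) mod length F)) \<subseteq> lpc -` G p \<inter> X" .
      obtain V1 where V1: "V1 \<in> \<V>" "G p \<subseteq> V1" using lr[OF pN] unfolding G_def by blast
      obtain V2 where V2: "V2 \<in> \<V>'" "V1 \<subseteq> V2"
        using V(3)[unfolded cover_refines_def, rule_format, OF V1(1)] by blast
      obtain B where B: "B \<in> \<C>" "lpc -` V2 \<inter> X \<subseteq> B"
        using V'(2)[unfolded cover_refines_def, rule_format, OF imageI[OF V2(1)]] by blast
      have "lpc -` G p \<inter> X \<subseteq> B" using V1(2) V2(2) B(2) by blast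
      then show ?thesis using arc B(1) by (meson subset_trans)
    qed
    then have "cover_refines (star_cover R F) \<C>" by (auto simp: cover_refines_def star_cover_def)
    then show "\<C> \<in> star_uniformity X R" unfolding star_char using C F(1) F3 by blast
  qed
qed

lemma covering_uniformity_novak_uniformity:
  assumes X: "X \<noteq> {}" and three: "\<And>a b. a \<in> X \<Longrightarrow> b \<in> X \<Longrightarrow> \<exists>c\<in>X. c \<noteq> a \<and> c \<noteq> b"
  shows "covering_uniformity X (novak_uniformity X R)"
proof -
  interpret nov: circ_order N RN by unfold_locales (rule circular_order_novak_nonempty[OF X])
  have "topspace (novak_topology X R) = N"
    by (simp add: novak_topology_def nov.topspace_interval)
  then have "covering_uniformity N (open_cover_uniformity (novak_topology X R))"
    using the_novak_uniformity(1)[OF X three] by (simp add: compatible_uniformity_def)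
  then have "covering_uniformity X
      (induced_uniformity X lpc (open_cover_uniformity (novak_topology X R)))"
    by (rule covering_uniformity_induced) (use lpc_in_novak_points in blast)
  then show ?thesis by (simp add: novak_uniformity_def the_novak_uniformity(2)[OF X three])
qed

section \<open>Circular orders with at most one point\<close>

lemma star_uniformity_subsingleton:
  assumes "X \<subseteq> {x}"
  shows "star_uniformity X R = {\<C>. cover_of X \<C> \<and> X \<in> \<C>}"
proof -
  have "\<not> 3 \<le> length F" if "cycle_in X R F" for F
  proof -
    have "card (set F) \<le> card {x}"
      using that assms by (intro card_mono) (auto simp: cycle_in_def)
    then show ?thesis using cycle_in_length[OF that] by simp
  qed
  then have "star_covers X R = {}" by (auto simp: star_covers_def)
  moreover have "cover_refines {X} \<C> \<longleftrightarrow> X \<in> \<C>" if "cover_of X \<C>" for \<C>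
    using that unfolding cover_of_def cover_refines_def by (metis Union_upper insertI1 singletonD subset_antisym subset_refl)
  ultimately show ?thesis unfolding star_uniformity_def generated_uniformity_def by auto
qed

text \<open>For empty \<open>X\<close> the empty relation is a gap, as there is no candidate for an
  extreme element. So the completion has exactly one point even then.\<close>

lemma novak_points_subsingleton:
  assumes "X \<subseteq> {x}"
  shows "N = {X \<times> X}"
proof -
  have eq: "L = X \<times> X" if "L \<in> N" for L
  proof -
    have "linear_order_on X L" using novak_point_cut[OF that] by (simp add: circ_cut_def)
    then show ?thesis using assms unfolding linear_order_on_iff by blast
  qed
  have "N \<noteq> {}"
  proof (cases "X = {}")
    case True
    have "circ_cut X R {}" unfolding circ_cut_def linear_order_on_iff using True by blast
    then have "circ_gap X R {}" using True by (simp add: circ_gap_def)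
    then show ?thesis by (auto simp: novak_points_def)
  next
    case False
    then show ?thesis using lpc_in_novak_points by blast
  qed
  then show ?thesis using eq by blast
qed

lemma novak_uniformity_subsingleton:
  assumes "X \<subseteq> {x}"
  shows "novak_uniformity X R = {\<C>. cover_of X \<C> \<and> X \<in> \<C>}"
proof -
  let ?T = "novak_topology X R"
  have N: "N = {X \<times> X}" by (rule novak_points_subsingleton[OF assms])
  have "RN = {}" unfolding novak_order_def N by auto
  then have "circular_order_on N RN" unfolding circular_order_on_def N by auto
  then interpret nov: circ_order N RN by unfold_locales
  have top: "topspace ?T = {X \<times> X}" unfolding novak_topology_def nov.topspace_interval by (rule N)
  have "compact_space ?T" unfolding compact_space_def top by (rule finite_imp_compactin) (simp_all add: top)
  moreover have "Hausdorff_space ?T" unfolding Hausdorff_space_def top by simp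
  ultimately have the: "(THE \<mu>. compatible_uniformity ?T \<mu>) = open_cover_uniformity ?T"
    using the_compatible_uniformity top by blast
  have big: "\<exists>V\<in>\<V>. X \<times> X \<in> V" if "\<V> \<in> open_cover_uniformity ?T" for \<V>
    using that unfolding open_cover_uniformity_def cover_of_def top by blast
  have lpc: "lpc y = X \<times> X" if "y \<in> X" for y using lpc_in_novak_points[OF that] N by blast
  have triv: "{{X \<times> X}} \<in> open_cover_uniformity ?T"
    using openin_topspace[of ?T] by (intro open_cover_in_open_cover_uniformity) (simp_all add: top)
  have "(\<exists>\<V>\<in>open_cover_uniformity ?T. cover_refines ((\<lambda>V. lpc -` V \<inter> X) ` \<V>) \<C>) \<longleftrightarrow> X \<in> \<C>"
    if C: "cover_of X \<C>" for \<C>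
  proof
    assume "\<exists>\<V>\<in>open_cover_uniformity ?T. cover_refines ((\<lambda>V. lpc -` V \<inter> X) ` \<V>) \<C>"
    then obtain \<V> V where "V \<in> \<V>" "X \<times> X \<in> V" "cover_refines ((\<lambda>V. lpc -` V \<inter> X) ` \<V>) \<C>"
      using big by blast
    then obtain B where "B \<in> \<C>" "lpc -` V \<inter> X \<subseteq> B" by (auto simp: cover_refines_def)
    moreover have "X \<subseteq> lpc -` V \<inter> X" using lpc \<open>X \<times> X \<in> V\<close> by auto
    moreover have "B \<subseteq> X" using C \<open>B \<in> \<C>\<close> by (auto simp: cover_of_def)
    ultimately show "X \<in> \<C>" by (metis subset_antisym subset_trans)
  next
    assume "X \<in> \<C>"
    then have "cover_refines ((\<lambda>V. lpc -` V \<inter> X) ` {{X \<times> X}}) \<C>" by (auto simp: cover_refines_def)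
    then show "\<exists>\<V>\<in>open_cover_uniformity ?T. cover_refines ((\<lambda>V. lpc -` V \<inter> X) ` \<V>) \<C>"
      using triv by blast
  qed
  then show ?thesis by (auto simp: novak_uniformity_def the induced_uniformity_def)
qed

lemma openin_interval_topology_subsingleton:
  assumes "X \<subseteq> {x}"
  shows "openin (interval_topology X R) U \<longleftrightarrow> U \<subseteq> X"
proof
  assume "openin (interval_topology X R) U"
  then show "U \<subseteq> X" using openin_subset topspace_interval by blast
next
  assume "U \<subseteq> X"
  then have "U = {} \<or> U = X" using assms by blast
  then show "openin (interval_topology X R) U"
    using openin_topspace[of "interval_topology X R"] topspace_interval by auto
qed

lemma covering_uniformity_trivial: "covering_uniformity X {\<C>. cover_of X \<C> \<and> X \<in> \<C>}"
  unfolding covering_uniformity_def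
proof (intro conjI allI impI ballI)
  let ?\<mu> = "{\<C>. cover_of X \<C> \<and> X \<in> \<C>}"
  have triv: "{X} \<in> ?\<mu>" by (simp add: cover_of_def)
  then show "?\<mu> \<noteq> {}" by blast
  show "cover_of X \<C>" if "\<C> \<in> ?\<mu>" for \<C> using that by simp
  show "\<D> \<in> ?\<mu>" if C: "\<C> \<in> ?\<mu>" and D: "cover_of X \<D>" "cover_refines \<C> \<D>" for \<C> \<D>
  proof -
    obtain B where B: "B \<in> \<D>" "X \<subseteq> B" using C D(2) unfolding cover_refines_def by blast
    then have "B = X" using D(1) by (auto simp: cover_of_def)
    then show ?thesis using B(1) D(1) by simp
  qed
  show "\<exists>\<E>\<in>?\<mu>. star_refines \<E> \<C> \<and> star_refines \<E> \<D>" if "\<C> \<in> ?\<mu>" "\<D> \<in> ?\<mu>" for \<C> \<D>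
  proof -
    have "star_refines {X} \<C>" "star_refines {X} \<D>"
      using that by (auto simp: star_refines_def cover_star_def)
    then show ?thesis using triv by blast
  qed
qed

lemma uniform_topology_trivial_subsingleton:
  assumes "X \<subseteq> {x}"
  shows "uniform_topology X {\<C>. cover_of X \<C> \<and> X \<in> \<C>} = interval_topology X R"
proof -
  have "\<exists>\<C>\<in>{\<C>. cover_of X \<C> \<and> X \<in> \<C>}. cover_star {y} \<C> \<subseteq> U" if "y \<in> U" "U \<subseteq> X" for y U
  proof
    show "{X} \<in> {\<C>. cover_of X \<C> \<and> X \<in> \<C>}" by (simp add: cover_of_def)
    show "cover_star {y} {X} \<subseteq> U" using that assms by (auto simp: cover_star_def)
  qed
  then show ?thesis
    unfolding topology_eq openin_uniform_topology[OF covering_uniformity_trivial]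
      openin_interval_topology_subsingleton[OF assms] by blast
qed

text \<open>\<open>{X}\<close> is put into the base because \<open>star_covers\<close> is empty when
  \<open>X\<close> has at most one point.\<close>

lemma star_uniformity_properties:
  assumes "card X \<noteq> 2"
  shows "covering_uniformity X (star_uniformity X R)"
    and "uniformity_base (star_uniformity X R) (insert {X} (star_covers X R))"
    and "uniform_topology X (star_uniformity X R) = interval_topology X R"
    and "star_uniformity X R = novak_uniformity X R"
proof -
  let ?G = "covering_uniformity X (star_uniformity X R) \<and>
    uniform_topology X (star_uniformity X R) = interval_topology X R \<and>
    star_uniformity X R = novak_uniformity X R"
  have ?G
  proof (cases "\<exists>x. X \<subseteq> {x}")
    case True
    then obtain x where x: "X \<subseteq> {x}" by blast
    show ?thesis
      unfolding star_uniformity_subsingleton[OF x] novak_uniformity_subsingleton[OF x]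
      using covering_uniformity_trivial uniform_topology_trivial_subsingleton[OF x] by blast
  next
    case False
    then have X: "X \<noteq> {}" by blast
    \<comment> \<open>For infinite \<open>X\<close> the value of \<open>card X\<close> is 0, so the
      hypothesis excludes two-point sets only. The points \<open>a\<close> and \<open>b\<close> may
      coincide, which is why \<open>X\<close> must not be a singleton.\<close>
    have three: "\<exists>c\<in>X. c \<noteq> a \<and> c \<noteq> b" if ab: "a \<in> X" "b \<in> X" for a b
    proof (rule ccontr)
      assume "\<not> (\<exists>c\<in>X. c \<noteq> a \<and> c \<noteq> b)"
      then have "X = {a, b}" using ab by blast
      moreover then have "a \<noteq> b" using False by blast
      ultimately show False using assms by simp
    qed
    note eq = star_uniformity_eq_novak_uniformity[OF X three]
    have "covering_uniformity X (star_uniformity X R)"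
      using covering_uniformity_novak_uniformity[OF X three] eq(1) by simp
    then show ?thesis using uniform_topology_star_uniformity[OF _ eq(2) three] eq(1) by blast
  qed
  then show "covering_uniformity X (star_uniformity X R)"
    "uniform_topology X (star_uniformity X R) = interval_topology X R"
    "star_uniformity X R = novak_uniformity X R" by blast+
  have "cover_of X \<C>" if "\<C> \<in> insert {X} (star_covers X R)" for \<C>
    using that Union_star_cover by (auto simp: cover_of_def star_covers_def)
  then have "insert {X} (star_covers X R) \<subseteq> star_uniformity X R"
    unfolding star_uniformity_def generated_uniformity_def by (blast intro: cover_refines_refl)
  then show "uniformity_base (star_uniformity X R) (insert {X} (star_covers X R))"
    unfolding uniformity_base_def star_uniformity_def generated_uniformity_def by blast
qed

end

theorem theorem9p5:
  fixes X :: "'a set" and R :: "('a \<times> 'a \<times> 'a) set"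
  assumes "circular_order_on X R"
    and "card X \<noteq> 2"
  shows "covering_uniformity X (star_uniformity X R)
    \<and> precompact_uniformity (star_uniformity X R)
    \<and> convex_uniformity X R (star_uniformity X R)
    \<and> uniform_topology X (star_uniformity X R) = interval_topology X R
    \<and> star_uniformity X R = novak_uniformity X R"
proof -
  interpret circ_order X R by unfold_locales (rule assms(1))
  note main = star_uniformity_properties[OF assms(2)]
  have fin: "finite \<C>" and conv: "\<And>C. C \<in> \<C> \<Longrightarrow> circ_convex X R C"
    if "\<C> \<in> insert {X} (star_covers X R)" for \<C>
  proof -
    show "finite \<C>" using that by (auto simp: star_covers_def star_cover_def)
    have "circ_convex X R X"
      using open_arc_subset by (auto simp: circ_convex_def closed_arc_def dest: in_X)
    then show "circ_convex X R C" if "C \<in> \<C>" for C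
      using that \<open>\<C> \<in> insert {X} (star_covers X R)\<close> circ_convex_open_arc
      by (auto simp: star_covers_def star_cover_def)
  qed
  have "precompact_uniformity (star_uniformity X R)"
    unfolding precompact_uniformity_def using main(2) fin by blast
  moreover have "convex_uniformity X R (star_uniformity X R)"
    unfolding convex_uniformity_def compatible_uniformity_def topspace_interval
    using main conv by blast
  ultimately show ?thesis using main by blast
qed

end
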